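(* Let $p\ge 4$ and $n\ge\max\{3p-1,\,p+8\}$ be integers. Let $\mathcal{L}$ be an $n$-dimensional non-split $p$-filiform complex Leibniz algebra whose associated naturally graded algebra $\operatorname{gr}\mathcal{L}$ is isomorphic either to $\tau(n,r_1,r_2,\dots,r_{p-2},n-p-1)$, where $3\le r_1<\dots<r_{p-2}<n-p-1$ are odd and $n-p-1$ is odd, or to $\tau(n,r_1,r_2,\dots,r_{p-2},n-p-2)$, where $3\le r_1<\dots<r_{p-2}<n-p-2$ are odd and $n-p-2$ is odd. Then $\mathcal{L}$ does not admit a gradation of maximum length.
   Context: All algebras are finite-dimensional over $\mathbb{C}$ and non-split, i.e. not a direct sum of two nonzero two-sided ideals. A (right) Leibniz algebra is an algebra $(\mathcal{L},[-,-])$ satisfying $[x,[y,z]]=[[x,y],z]-[[x,z],y]$ for all $x,y,z$. Its descending central sequence is $\mathcal{L}^1=\mathcal{L}$, $\mathcal{L}^{k+1}=[\mathcal{L}^k,\mathcal{L}]$; $\mathcal{L}$ is nilpotent with nilindex $s$ if $\mathcal{L}^s\ne 0$ and $\mathcal{L}^{s+1}=0$. Let $\mathcal{L}$ be nilpotent. For $x\in\mathcal{L}\setminus\mathcal{L}^2$ let $R_x(y)=[y,x]$ and let $C(x)$ be the non-increasing sequence of sizes of the Jordan blocks of the nilpotent operator $R_x$. The characteristic sequence $C(\mathcal{L})$ is the lexicographic maximum of $C(x)$ over $x\in\mathcal{L}\setminus\mathcal{L}^2$. An $n$-dimensional nilpotent Leibniz algebra is $p$-filiform ($0\le p<n$)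 if $C(\mathcal{L})=(n-p,1,\dots,1)$ with $p$ ones. The associated naturally graded algebra is $\operatorname{gr}\mathcal{L}=\bigoplus_{i=1}^{s}\mathcal{L}^i/\mathcal{L}^{i+1}$ with the induced product. A $\mathbb{Z}$-gradation $\mathcal{L}=\bigoplus_{i\in\mathbb{Z}}V_i$, $[V_i,V_j]\subseteq V_{i+j}$ for all $i,j$, with finitely many nonzero $V_i$, is connected if $\mathcal{L}=V_{k}\oplus V_{k+1}\oplus\dots\oplus V_{k+t}$ for some $k\in\mathbb{Z}$, $t\ge 0$, with $V_{k+i}\neq 0$ for all $0\le i\le t$; its length is $t+1$. A gradation of maximum length is a connected gradation of length $\dim\mathcal{L}$ (so every $V_{k+i}$ is one-dimensional). The $n$-dimensional Lie algebras below have basis $\{x_0,x_1,\dots,x_{n-p},y_1,\dots,y_{p-1}\}$; brackets not obtained from the listed ones by antisymmetry are zero. $\tau(n,r_1,\dots,r_{p-2},n-p-1)$: $[x_0,x_i]=x_{i+1}$ for $1\le i\le n-p-1$; $[x_i,x_{r_j-i}]=(-1)^{i-1}y_j$ for $1\le i\le\frac{r_j-1}{2}$, $1\le j\le p-2$; $[x_i,x_{n-p-1-i}]=(-1)^{i-1}(x_{n-p-1}+y_{p-1})$ for $1\le i\le\frac{n-p-2}{2}$; $[x_i,x_{n-p-i}]=(-1)^{i-1}\frac{n-2i-p}{2}x_{n-p}$ for $1\le i\le\frac{n-p-2}{2}$; $[x_1,y_{p-1}]=\frac{p+2-n}{2}x_{n-p}$. $\tau(n,r_1,\dots,r_{p-2},n-p-2)$: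 $[x_0,x_i]=x_{i+1}$ for $1\le i\le n-p-1$; $[x_i,x_{r_j-i}]=(-1)^{i-1}y_j$ for $1\le i\le\frac{r_j-1}{2}$, $1\le j\le p-2$; $[x_i,x_{n-p-2-i}]=(-1)^{i-1}(x_{n-p-2}+y_{p-1})$ for $1\le i\le\frac{n-p-3}{2}$; $[x_i,x_{n-p-1-i}]=(-1)^{i-1}\frac{n-p-1-2i}{2}x_{n-p-1}$ for $1\le i\le\frac{n-p-3}{2}$; $[x_i,x_{n-p-i}]=(-1)^{i}(i-1)\frac{n-p-1-i}{2}x_{n-p}$ for $2\le i\le\frac{n-p-1}{2}$; $[x_i,y_{p-1}]=\frac{p+3-n}{2}x_{n-p-2+i}$ for $1\le i\le 2$. *)

theory Defs
  imports Complex_Main "HOL-Library.FuncSet" "Jordan_Normal_Form.Jordan_Normal_Form"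
begin

section \<open>Complex algebras with explicit carrier\<close>

record 'a calg =
  acarrier :: "'a set"
  aadd :: "'a \<Rightarrow> 'a \<Rightarrow> 'a"
  ascale :: "complex \<Rightarrow> 'a \<Rightarrow> 'a"
  abr :: "'a \<Rightarrow> 'a \<Rightarrow> 'a"

definition calg_iso :: "'a calg \<Rightarrow> 'b calg \<Rightarrow> bool" where
  "calg_iso A B \<longleftrightarrow> (\<exists>h. bij_betw h (acarrier A) (acarrier B) \<and>
     (\<forall>x\<in>acarrier A. \<forall>y\<in>acarrier A. h (aadd A x y) = aadd B (h x) (h y)) \<and>
     (\<forall>c. \<forall>x\<in>acarrier A. h (ascale A c x) = ascale B c (h x)) \<and>
     (\<forall>x\<in>acarrier A. \<forall>y\<in>acarrier A. h (abr A x y) = abr B (h x) (h y)))"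


section \<open>Finite-dimensional complex right Leibniz algebras\<close>

locale leibniz_algebra = vector_space scale
  for scale :: "complex \<Rightarrow> 'a::ab_group_add \<Rightarrow> 'a" (infixr "*s" 75) +
  fixes br :: "'a \<Rightarrow> 'a \<Rightarrow> 'a"
  assumes fin_dim: "\<exists>B. finite B \<and> span B = UNIV"
    and linear_left: "Vector_Spaces.linear scale scale (\<lambda>x. br x y)"
    and linear_right: "Vector_Spaces.linear scale scale (\<lambda>y. br x y)"
    and leibniz: "br x (br y z) = br (br x y) z - br (br x z) y"
begin

definition two_sided_ideal :: "'a set \<Rightarrow> bool" where
  "two_sided_ideal I \<longleftrightarrow> subspace I \<and> (\<forall>x\<in>I. \<forall>y. br x y \<in> I \<and> br y x \<in> I)"

definition split :: bool where
  "split \<longleftrightarrow> (\<exists>I J. two_sided_ideal I \<and> two_sided_ideal J \<and> I \<noteq> {0} \<and> J \<noteq> {0} \<and>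
     I \<inter> J = {0} \<and> {x + y |x y. x \<in> I \<and> y \<in> J} = UNIV)"

text \<open>The descending central sequence starts at index 1; the value at 0 is a dummy.\<close>

fun lcs :: "nat \<Rightarrow> 'a set" where
  "lcs 0 = UNIV"
| "lcs (Suc 0) = UNIV"
| "lcs (Suc (Suc k)) = span {br x y |x y. x \<in> lcs (Suc k)}"

definition has_nilindex :: "nat \<Rightarrow> bool" where
  "has_nilindex s \<longleftrightarrow> 1 \<le> s \<and> lcs s \<noteq> {0} \<and> lcs (Suc s) = {0}"

definition nilpotent :: bool where
  "nilpotent \<longleftrightarrow> (\<exists>s. has_nilindex s)"

definition nilindex :: nat where
  "nilindex = (THE s. has_nilindex s)"


subsection \<open>Characteristic sequence\<close>

definition ordered_basis :: "(nat \<Rightarrow> 'a) \<Rightarrow> bool" where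
  "ordered_basis b \<longleftrightarrow> inj_on b {..<dim UNIV} \<and> independent (b ` {..<dim UNIV}) \<and>
     span (b ` {..<dim UNIV}) = UNIV"

definition is_matrix_of :: "complex mat \<Rightarrow> (nat \<Rightarrow> 'a) \<Rightarrow> ('a \<Rightarrow> 'a) \<Rightarrow> bool" where
  "is_matrix_of A b T \<longleftrightarrow> A \<in> carrier_mat (dim UNIV) (dim UNIV) \<and>
     (\<forall>j<dim UNIV. T (b j) = (\<Sum>i<dim UNIV. (A $$ (i, j)) *s b i))"

definition jordan_sizes :: "('a \<Rightarrow> 'a) \<Rightarrow> nat list \<Rightarrow> bool" where
  "jordan_sizes T c \<longleftrightarrow> (\<exists>b A n_as. ordered_basis b \<and> is_matrix_of A b T \<and>
     jordan_nf A n_as \<and> c = rev (sort (map fst n_as)))"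

definition is_char_seq :: "nat list \<Rightarrow> bool" where
  "is_char_seq c \<longleftrightarrow>
     (\<exists>x. x \<notin> lcs 2 \<and> jordan_sizes (\<lambda>y. br y x) c) \<and>
     (\<forall>x d. x \<notin> lcs 2 \<and> jordan_sizes (\<lambda>y. br y x) d \<longrightarrow>
        d = c \<or> (d, c) \<in> lexord {(a, b). a < b})"

definition p_filiform :: "nat \<Rightarrow> bool" where
  "p_filiform p \<longleftrightarrow> nilpotent \<and> p < dim UNIV \<and>
     is_char_seq ((dim UNIV - p) # replicate p 1)"


subsection \<open>Associated naturally graded algebra\<close>

definition lcs_quot :: "nat \<Rightarrow> 'a set set" where
  "lcs_quot i = (\<lambda>x. (+) x ` lcs (Suc i)) ` lcs i"

text \<open>
  An element of the direct sum is a tuple of cosets, one for each \<open>i\<close> from 1 to the nilindex.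
  The operations are set-wise: adding \<open>lcs (Suc i)\<close> in the scalar multiplication matters
  for the scalar 0, and adding \<open>lcs (Suc k)\<close> in the bracket turns the set of all sums of
  brackets of representatives into a coset.
\<close>

definition gr :: "(nat \<Rightarrow> 'a set) calg" where
  "gr = \<lparr>
     acarrier = (\<Pi>\<^sub>E i\<in>{1..nilindex}. lcs_quot i),
     aadd = (\<lambda>f g. \<lambda>i\<in>{1..nilindex}. {x + y |x y. x \<in> f i \<and> y \<in> g i}),
     ascale = (\<lambda>c f. \<lambda>i\<in>{1..nilindex}. {c *s x + z |x z. x \<in> f i \<and> z \<in> lcs (Suc i)}),
     abr = (\<lambda>f g. \<lambda>k\<in>{1..nilindex}.
       {(\<Sum>i\<in>{1..<k}. br (x i) (y (k - i))) + z |x y z.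
          (\<forall>i\<in>{1..<k}. x i \<in> f i \<and> y i \<in> g i) \<and> z \<in> lcs (Suc k)}) \<rparr>"


subsection \<open>Gradations\<close>

definition gradation :: "(int \<Rightarrow> 'a set) \<Rightarrow> bool" where
  "gradation V \<longleftrightarrow> (\<forall>i. subspace (V i)) \<and> finite {i. V i \<noteq> {0}} \<and>
     (\<forall>x. \<exists>!f. (\<forall>i. f i \<in> V i) \<and> x = (\<Sum>i | V i \<noteq> {0}. f i)) \<and>
     (\<forall>i j. \<forall>x\<in>V i. \<forall>y\<in>V j. br x y \<in> V (i + j))"

definition connected_gradation :: "(int \<Rightarrow> 'a set) \<Rightarrow> nat \<Rightarrow> bool" where
  "connected_gradation V l \<longleftrightarrow> gradation V \<and>
     (\<exists>k t. {i. V i \<noteq> {0}} = {k..k + int t} \<and> l = t + 1)"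

definition admits_max_length_gradation :: bool where
  "admits_max_length_gradation \<longleftrightarrow> (\<exists>V. connected_gradation V (dim UNIV))"

end


section \<open>The Lie algebras \<open>\<tau>\<close>\<close>

datatype tau_idx = BX nat | BY nat

definition tau_basis :: "nat \<Rightarrow> nat \<Rightarrow> tau_idx set" where
  "tau_basis n p = BX ` {0..n - p} \<union> BY ` {1..p - 1}"

definition kd :: "tau_idx \<Rightarrow> tau_idx \<Rightarrow> complex" where
  "kd a b = (if a = b then 1 else 0)"

text \<open>
  The functions \<open>tau1_table\<close> and \<open>tau2_table\<close> give the coordinates of the listed brackets only.
  No pair of basis elements is listed in both orders, so antisymmetrising the table in
  \<open>antisym_alg\<close> yields all brackets. Vectors are coordinate functions supported on the basis.
\<close>

fun tau1_table :: "nat \<Rightarrow> nat \<Rightarrow> (nat \<Rightarrow> nat) \<Rightarrow> tau_idx \<Rightarrow> tau_idx \<Rightarrow> tau_idx \<Rightarrow> complex" where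
  "tau1_table n p r (BX i) (BX k) l =
     (if i = 0 \<and> 1 \<le> k \<and> k \<le> n - p - 1 then kd (BX (k + 1)) l else 0)
   + (\<Sum>j\<in>{1..p - 2}. if 1 \<le> i \<and> 2 * i \<le> r j - 1 \<and> k = r j - i
        then (- 1) ^ (i - 1) * kd (BY j) l else 0)
   + (if 1 \<le> i \<and> 2 * i \<le> n - p - 2 \<and> k = n - p - 1 - i
        then (- 1) ^ (i - 1) * (kd (BX (n - p - 1)) l + kd (BY (p - 1)) l) else 0)
   + (if 1 \<le> i \<and> 2 * i \<le> n - p - 2 \<and> k = n - p - i
        then (- 1) ^ (i - 1) * ((of_nat n - 2 * of_nat i - of_nat p) / 2) * kd (BX (n - p)) l
        else 0)"
| "tau1_table n p r (BX i) (BY j) l =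
     (if i = 1 \<and> j = p - 1
        then ((of_nat p + 2 - of_nat n) / 2) * kd (BX (n - p)) l else 0)"
| "tau1_table n p r (BY j) b l = 0"

fun tau2_table :: "nat \<Rightarrow> nat \<Rightarrow> (nat \<Rightarrow> nat) \<Rightarrow> tau_idx \<Rightarrow> tau_idx \<Rightarrow> tau_idx \<Rightarrow> complex" where
  "tau2_table n p r (BX i) (BX k) l =
     (if i = 0 \<and> 1 \<le> k \<and> k \<le> n - p - 1 then kd (BX (k + 1)) l else 0)
   + (\<Sum>j\<in>{1..p - 2}. if 1 \<le> i \<and> 2 * i \<le> r j - 1 \<and> k = r j - i
        then (- 1) ^ (i - 1) * kd (BY j) l else 0)
   + (if 1 \<le> i \<and> 2 * i \<le> n - p - 3 \<and> k = n - p - 2 - i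
        then (- 1) ^ (i - 1) * (kd (BX (n - p - 2)) l + kd (BY (p - 1)) l) else 0)
   + (if 1 \<le> i \<and> 2 * i \<le> n - p - 3 \<and> k = n - p - 1 - i
        then (- 1) ^ (i - 1) * ((of_nat n - of_nat p - 1 - 2 * of_nat i) / 2)
             * kd (BX (n - p - 1)) l
        else 0)
   + (if 2 \<le> i \<and> 2 * i \<le> n - p - 1 \<and> k = n - p - i
        then (- 1) ^ i * (of_nat i - 1) * ((of_nat n - of_nat p - 1 - of_nat i) / 2)
             * kd (BX (n - p)) l
        else 0)"
| "tau2_table n p r (BX i) (BY j) l =
     (if 1 \<le> i \<and> i \<le> 2 \<and> j = p - 1
        then ((of_nat p + 3 - of_nat n) / 2) * kd (BX (n - p - 2 + i)) l else 0)"
| "tau2_table n p r (BY j) b l = 0"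

definition antisym_alg ::
    "tau_idx set \<Rightarrow> (tau_idx \<Rightarrow> tau_idx \<Rightarrow> tau_idx \<Rightarrow> complex) \<Rightarrow> (tau_idx \<Rightarrow> complex) calg" where
  "antisym_alg B t = \<lparr>
     acarrier = {f. \<forall>l. l \<notin> B \<longrightarrow> f l = 0},
     aadd = (\<lambda>f g l. f l + g l),
     ascale = (\<lambda>c f l. c * f l),
     abr = (\<lambda>f g l. \<Sum>a\<in>B. \<Sum>b\<in>B. f a * g b * (t a b l - t b a l)) \<rparr>"

definition tau1 :: "nat \<Rightarrow> nat \<Rightarrow> (nat \<Rightarrow> nat) \<Rightarrow> (tau_idx \<Rightarrow> complex) calg" where
  "tau1 n p r = antisym_alg (tau_basis n p) (tau1_table n p r)"

definition tau2 :: "nat \<Rightarrow> nat \<Rightarrow> (nat \<Rightarrow> nat) \<Rightarrow> (tau_idx \<Rightarrow> complex) calg" where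
  "tau2 n p r = antisym_alg (tau_basis n p) (tau2_table n p r)"

definition admissible :: "nat \<Rightarrow> (nat \<Rightarrow> nat) \<Rightarrow> nat \<Rightarrow> bool" where
  "admissible p r m \<longleftrightarrow> 3 \<le> r 1 \<and> (\<forall>j\<in>{1..<p - 2}. r j < r (j + 1)) \<and> r (p - 2) < m \<and>
     (\<forall>j\<in>{1..p - 2}. odd (r j)) \<and> odd m"

end

theory Submission
  imports Defs
begin

text \<open>
  Suppose the algebra has a gradation with one-dimensional components. It is generated by two
  homogeneous elements \<open>u\<close>, \<open>v\<close> of weights \<open>a \<noteq> b\<close>, with leading terms in the span of \<open>x\<^sub>0\<close>, \<open>x\<^sub>1\<close>.
  The last term of the descending central sequence is one-dimensional, so all words in \<open>u\<close>, \<open>v\<close> that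
  survive there have the same weight. Comparing such words forces, up to exchanging and rescaling
  \<open>u\<close> and \<open>v\<close>, the leading terms \<open>v = x\<^sub>1\<close> and \<open>u = x\<^sub>0 - 2 / (m + 1) x\<^sub>1\<close>, where \<open>m\<close> is
  the degree of \<open>y\<^bsub>p-1\<^esub>\<close>. Now \<open>n\<close> words in \<open>u\<close>, \<open>v\<close> have independent leading terms, hence their
  weights \<open>a\<close>, \<open>b + i a\<close> for \<open>0 \<le> i < m\<close>, and \<open>2 b + s a\<close> for \<open>s\<close> among
  \<open>r\<^sub>j - 2\<close>, \<open>m - 2\<close>, \<open>m - 1\<close> and possibly \<open>m\<close>, are \<open>n\<close> distinct integers forming an interval.
  This is impossible: the arithmetic progression of difference \<open>a\<close> is too long unless \<open>\<bar>a\<bar> = 1\<close>,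
  apart from one small case, and for \<open>\<bar>a\<bar> = 1\<close> the weights \<open>2 b + s a\<close> collide with it or leave a gap.
\<close>

section \<open>The central filtration and the associated graded algebra\<close>

context leibniz_algebra
begin

lemma br_add_left: "br (x + y) z = br x z + br y z"
  and br_scale_left: "br (c *s x) z = c *s br x z"
  using linear_left[of z] by (auto simp: Vector_Spaces.linear_iff)

lemma br_add_right: "br x (y + z) = br x y + br x z"
  and br_scale_right: "br x (c *s y) = c *s br x y"
  using linear_right[of x] by (auto simp: Vector_Spaces.linear_iff)

lemma br_zero_left [simp]: "br 0 y = 0" and br_zero_right [simp]: "br y 0 = 0"
  using br_scale_left[of 0 0 y] br_scale_right[of y 0 0] by auto

lemma lcs_Suc: "k \<ge> 1 \<Longrightarrow> lcs (Suc k) = span {br x y |x y. x \<in> lcs k}"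
  by (cases k) auto

lemma subspace_lcs: "subspace (lcs k)"
  by (cases k rule: lcs.cases) auto

lemma lcs_Suc_subset: "lcs (Suc k) \<subseteq> lcs k"
proof (induction k)
  case (Suc k)
  then show ?case
    by (cases k) (auto intro!: span_mono)
qed auto

lemma lcs_antimono: "i \<le> j \<Longrightarrow> lcs j \<subseteq> lcs i"
  by (rule lift_Suc_antimono_le[of lcs]) (auto simp: lcs_Suc_subset)

lemmas lcs_add = subspace_add[OF subspace_lcs]
  and lcs_scale = subspace_scale[OF subspace_lcs]
  and lcs_zero [simp] = subspace_0[OF subspace_lcs]
  and lcs_diff = subspace_diff[OF subspace_lcs]
  and lcs_sum = subspace_sum[OF subspace_lcs]

lemma br_in_lcs_Suc: "k \<ge> 1 \<Longrightarrow> x \<in> lcs k \<Longrightarrow> br x y \<in> lcs (Suc k)"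
  by (auto simp: lcs_Suc intro!: span_base)

text \<open>Induction on \<open>j\<close>: the Leibniz identity turns right multiplication by
  \<open>br y1 y2\<close> into right multiplications by \<open>y1\<close> and \<open>y2\<close> in
  both orders.\<close>

lemma br_in_lcs_add:
  assumes "i \<ge> 1" "j \<ge> 1" "x \<in> lcs i" "y \<in> lcs j"
  shows "br x y \<in> lcs (i + j)"
  using assms(2,1,3,4)
proof (induction j arbitrary: i x y rule: dec_induct)
  case base
  then show ?case using br_in_lcs_Suc by simp
next
  case (step j)
  note IH = step.IH and i = step.prems(1) and x = step.prems(2)
  from step.prems(3) have "y \<in> span {br x y |x y. x \<in> lcs j}"
    using step.hyps by (simp add: lcs_Suc)
  then show ?case
  proof (induction rule: span_induct_alt)
    case base
    then show ?case by simp
  next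
    case (step c w z)
    then obtain y1 y2 where w: "w = br y1 y2" and y1: "y1 \<in> lcs j" by blast
    have "br (br x y1) y2 \<in> lcs (i + Suc j)"
      using br_in_lcs_Suc[OF _ IH[OF i x y1]] i by simp
    moreover have "br (br x y2) y1 \<in> lcs (i + Suc j)"
      using IH[OF _ br_in_lcs_Suc[OF i x] y1] by simp
    ultimately show ?case
      unfolding br_add_right br_scale_right w leibniz
      by (intro lcs_add lcs_scale lcs_diff step.IH)
  qed
qed

lemma has_nilindex_unique: "has_nilindex s \<Longrightarrow> has_nilindex t \<Longrightarrow> s = t"
proof (induction s t rule: linorder_wlog)
  case (le s t)
  show ?case
  proof (rule ccontr)
    assume "s \<noteq> t"
    with le have "lcs t \<subseteq> lcs (Suc s)" by (intro lcs_antimono) auto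
    with le show False using subspace_0[OF subspace_lcs, of t] by (auto simp: has_nilindex_def)
  qed
qed auto

lemma has_nilindex_nilindex: "nilpotent \<Longrightarrow> has_nilindex nilindex"
  unfolding nilindex_def nilpotent_def using has_nilindex_unique by (metis theI)

lemma lcs_beyond_nilindex:
  assumes "nilpotent" "k > nilindex"
  shows "lcs k = {0}"
proof -
  have "lcs k \<subseteq> lcs (Suc nilindex)" using assms by (intro lcs_antimono) auto
  then show ?thesis
    using has_nilindex_nilindex[OF assms(1)] lcs_zero[of k] by (auto simp: has_nilindex_def)
qed

section \<open>Homogeneous elements of the associated graded algebra\<close>

definition gr_elem :: "nat \<Rightarrow> 'a \<Rightarrow> nat \<Rightarrow> 'a set" where
  "gr_elem k x = (\<lambda>i\<in>{1..nilindex}. (+) (if i = k then x else 0) ` lcs (Suc i))"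

lemma coset_zero: "x \<in> lcs k \<Longrightarrow> (+) x ` lcs k = lcs k"
proof (intro equalityI subsetI)
  fix y assume "x \<in> lcs k" "y \<in> lcs k"
  then show "y \<in> (+) x ` lcs k"
    by (intro image_eqI[of _ _ "y - x"]) (auto intro: lcs_diff)
qed (auto intro: lcs_add)

lemma coset_eq_iff: "(+) x ` lcs k = (+) y ` lcs k \<longleftrightarrow> x - y \<in> lcs k"
proof
  assume "(+) x ` lcs k = (+) y ` lcs k"
  moreover have "x \<in> (+) x ` lcs k" by (rule image_eqI[of _ _ 0]) auto
  ultimately show "x - y \<in> lcs k" by auto
next
  assume "x - y \<in> lcs k"
  then have "(+) y ` ((+) (x - y) ` lcs k) = (+) y ` lcs k" by (simp add: coset_zero)
  then show "(+) x ` lcs k = (+) y ` lcs k" by (simp add: image_image add.assoc[symmetric])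
qed

lemma coset_add:
  "{u + v |u v. u \<in> (+) x ` lcs k \<and> v \<in> (+) y ` lcs k} = (+) (x + y) ` lcs k"
proof (intro equalityI subsetI)
  fix z assume "z \<in> (+) (x + y) ` lcs k"
  then obtain w where "w \<in> lcs k" "z = (x + 0) + (y + w)" by (auto simp: ac_simps)
  moreover from this have "x + 0 \<in> (+) x ` lcs k" "y + w \<in> (+) y ` lcs k"
    using lcs_zero[of k] by blast+
  ultimately show "z \<in> {u + v |u v. u \<in> (+) x ` lcs k \<and> v \<in> (+) y ` lcs k}" by blast
next
  fix z assume "z \<in> {u + v |u v. u \<in> (+) x ` lcs k \<and> v \<in> (+) y ` lcs k}"
  then obtain v w where "v \<in> lcs k" "w \<in> lcs k" "z = (x + y) + (v + w)" by (auto simp: ac_simps)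
  then show "z \<in> (+) (x + y) ` lcs k" by (auto intro: lcs_add)
qed

lemma coset_scale:
  "{c *s u + v |u v. u \<in> (+) x ` lcs k \<and> v \<in> lcs k} = (+) (c *s x) ` lcs k"
proof (intro equalityI subsetI)
  fix z assume "z \<in> (+) (c *s x) ` lcs k"
  then obtain w where "w \<in> lcs k" "z = c *s (x + 0) + w" by auto
  moreover have "x + 0 \<in> (+) x ` lcs k" by (rule imageI) simp
  ultimately show "z \<in> {c *s u + v |u v. u \<in> (+) x ` lcs k \<and> v \<in> lcs k}" by blast
next
  fix z assume "z \<in> {c *s u + v |u v. u \<in> (+) x ` lcs k \<and> v \<in> lcs k}"
  then obtain v w where "v \<in> lcs k" "w \<in> lcs k" "z = c *s x + (c *s v + w)"
    by (auto simp: scale_right_distrib ac_simps)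
  then show "z \<in> (+) (c *s x) ` lcs k" by (auto intro: lcs_add lcs_scale)
qed

lemma gr_elem_in_carrier: "x \<in> lcs k \<Longrightarrow> gr_elem k x \<in> acarrier gr"
  by (auto simp: gr_def gr_elem_def lcs_quot_def)

lemma gr_elem_add: "aadd gr (gr_elem k x) (gr_elem k y) = gr_elem k (x + y)"
  unfolding gr_def gr_elem_def calg.simps
  by (rule restrict_ext) (simp only: restrict_apply' coset_add, simp)

lemma gr_elem_scale: "ascale gr c (gr_elem k x) = gr_elem k (c *s x)"
  unfolding gr_def gr_elem_def calg.simps
  by (rule restrict_ext) (simp only: restrict_apply' coset_scale, simp)

lemma gr_elem_eq_zero: "x \<in> lcs (Suc k) \<Longrightarrow> gr_elem k x = gr_elem j 0"
  unfolding gr_elem_def by (intro restrict_ext) (auto simp: coset_zero)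

lemma gr_elem_eqD:
  assumes "nilpotent" "gr_elem k x = gr_elem k 0" "x \<in> lcs k" "k \<ge> 1"
  shows "x \<in> lcs (Suc k)"
proof (cases "k \<le> nilindex")
  case True
  with assms(4) fun_cong[OF assms(2), of k] have "(+) x ` lcs (Suc k) = (+) 0 ` lcs (Suc k)"
    by (simp add: gr_elem_def)
  then show ?thesis by (simp only: coset_eq_iff diff_0_right)
next
  case False
  with lcs_beyond_nilindex[OF assms(1), of k] assms(3) show ?thesis by auto
qed

text \<open>Representatives are free up to the next term of the sequence, and by
  \<open>br_in_lcs_add\<close> such a change moves each summand only within
  \<open>lcs (Suc q)\<close>. Hence only \<open>i = k\<close>, \<open>q = Suc k\<close>
  contributes.\<close>

lemma gr_elem_br:
  assumes x: "x \<in> lcs k" and k: "k \<ge> 1"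
  shows "abr gr (gr_elem k x) (gr_elem 1 y) = gr_elem (Suc k) (br x y)"
proof -
  let ?s = nilindex
  have "{(\<Sum>i\<in>{1..<q}. br (u i) (v (q - i))) + z |u v z.
          (\<forall>i\<in>{1..<q}. u i \<in> gr_elem k x i \<and> v i \<in> gr_elem 1 y i) \<and> z \<in> lcs (Suc q)} =
        (+) (if q = Suc k then br x y else 0) ` lcs (Suc q)" (is "?A = ?B")
    if q: "q \<in> {1..?s}" for q
  proof (intro equalityI subsetI)
    fix w assume "w \<in> ?A"
    then obtain u v z where w: "w = (\<Sum>i\<in>{1..<q}. br (u i) (v (q - i))) + z"
      and u: "\<And>i. i \<in> {1..<q} \<Longrightarrow> u i \<in> gr_elem k x i"
      and v: "\<And>i. i \<in> {1..<q} \<Longrightarrow> v i \<in> gr_elem 1 y i" and z: "z \<in> lcs (Suc q)" by blast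
    have u': "u i - (if i = k then x else 0) \<in> lcs (Suc i)" if "i \<in> {1..<q}" for i
      using u[OF that] that q by (auto simp: gr_elem_def)
    have v': "v i - (if i = 1 then y else 0) \<in> lcs (Suc i)" if "i \<in> {1..<q}" for i
      using v[OF that] that q by (auto simp: gr_elem_def)
    have summand: "br (u i) (v (q - i)) - (if i = k \<and> q = Suc k then br x y else 0) \<in> lcs (Suc q)"
      if i: "i \<in> {1..<q}" for i
    proof -
      define du where "du = u i - (if i = k then x else 0)"
      define dv where "dv = v (q - i) - (if q - i = 1 then y else 0)"
      define u0 where "u0 = (if i = k then x else 0)"
      define v0 where "v0 = (if q - i = 1 then y else 0)"
      have qi: "q - i \<in> {1..<q}" using i by auto
      have du: "du \<in> lcs (Suc i)" and dv: "dv \<in> lcs (Suc (q - i))"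
        unfolding du_def dv_def by (intro u' v' i qi)+
      have u0: "u0 \<in> lcs i" using x by (auto simp: u0_def)
      have v0: "v0 \<in> lcs (q - i)" by (auto simp: v0_def)
      have "br (u i) (v (q - i)) = br (u0 + du) (v0 + dv)"
        by (simp add: du_def dv_def u0_def v0_def)
      also have "\<dots> = br u0 v0 + (br u0 dv + br du (v0 + dv))"
        by (simp add: br_add_left br_add_right ac_simps)
      finally have *: "br (u i) (v (q - i)) = br u0 v0 + (br u0 dv + br du (v0 + dv))" .
      have "br u0 dv \<in> lcs (Suc q)"
        using br_in_lcs_add[OF _ _ u0 dv] i by simp
      moreover have "v0 + dv \<in> lcs (q - i)"
        using v0 dv lcs_Suc_subset by (intro lcs_add) auto
      with br_in_lcs_add[OF _ _ du this] have "br du (v0 + dv) \<in> lcs (Suc q)"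
        using i by (simp add: Suc_le_eq)
      moreover have "br u0 v0 = (if i = k \<and> q = Suc k then br x y else 0)"
        using i by (auto simp: u0_def v0_def)
      ultimately show ?thesis unfolding * by (auto intro: lcs_add)
    qed
    have "(\<Sum>i\<in>{1..<q}. br (u i) (v (q - i))) -
          (\<Sum>i\<in>{1..<q}. if i = k \<and> q = Suc k then br x y else 0) \<in> lcs (Suc q)"
      unfolding sum_subtractf[symmetric] by (rule lcs_sum) (rule summand)
    moreover have "(\<Sum>i\<in>{1..<q}. if i = k \<and> q = Suc k then br x y else 0) =
          (if q = Suc k then br x y else 0)"
      using k by (cases "q = Suc k") (simp_all add: sum.delta)
    ultimately have "(\<Sum>i\<in>{1..<q}. br (u i) (v (q - i))) - (if q = Suc k then br x y else 0)
        \<in> lcs (Suc q)" by (simp only:)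
    from lcs_add[OF this z] show "w \<in> ?B" by (rule rev_image_eqI) (simp add: w)
  next
    fix w assume "w \<in> ?B"
    then obtain z where z: "z \<in> lcs (Suc q)" and w: "w = (if q = Suc k then br x y else 0) + z"
      by auto
    define u where "u i = (if i = k then x else 0)" for i
    define v where "v i = (if i = 1 then y else 0)" for i :: nat
    have "br (u i) (v (q - i)) = (if i = k \<and> q = Suc k then br x y else 0)" if "i \<in> {1..<q}" for i
      using that by (auto simp: u_def v_def)
    then have "(\<Sum>i\<in>{1..<q}. br (u i) (v (q - i))) = (\<Sum>i\<in>{1..<q}. if i = k \<and> q = Suc k then br x y else 0)"
      by (rule sum.cong[OF refl])
    also have "\<dots> = (if q = Suc k then br x y else 0)"
      using k by (cases "q = Suc k") (simp_all add: sum.delta)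
    finally have "w = (\<Sum>i\<in>{1..<q}. br (u i) (v (q - i))) + z" using w by simp
    moreover have "\<forall>i\<in>{1..<q}. u i \<in> gr_elem k x i \<and> v i \<in> gr_elem 1 y i"
      using q by (auto simp del: lcs.simps simp: gr_elem_def u_def v_def intro!: image_eqI[of _ _ 0])
    ultimately show "w \<in> ?A" using z by blast
  qed
  then show ?thesis
    unfolding gr_def gr_elem_def[of "Suc k"] calg.simps by (rule restrict_ext)
qed

text \<open>An element of \<open>gr\<close> is built from its homogeneous components one degree at a
  time; \<open>G j\<close> is its truncation to degrees up to \<open>j\<close>.\<close>

lemma gr_induct [consumes 1, case_names zero step]:
  assumes g: "g \<in> acarrier gr"
    and zero: "P (gr_elem 1 0)"
    and step: "\<And>f k x. f \<in> acarrier gr \<Longrightarrow> P f \<Longrightarrow> 1 \<le> k \<Longrightarrow> x \<in> lcs k \<Longrightarrow> P (aadd gr f (gr_elem k x))"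
  shows "P g"
proof -
  have "\<forall>i\<in>{1..nilindex}. \<exists>x. x \<in> lcs i \<and> g i = (+) x ` lcs (Suc i)"
    using g by (auto simp: gr_def lcs_quot_def PiE_def Pi_def)
  then obtain X where X: "\<And>i. i \<in> {1..nilindex} \<Longrightarrow> X i \<in> lcs i \<and> g i = (+) (X i) ` lcs (Suc i)"
    by metis
  define G where "G j = (\<lambda>i\<in>{1..nilindex}. (+) (if i \<le> j then X i else 0) ` lcs (Suc i))" for j
  have G: "j \<le> nilindex \<Longrightarrow> P (G j) \<and> G j \<in> acarrier gr" for j
  proof (induction j)
    case 0
    have "G 0 = gr_elem 1 0" unfolding G_def gr_elem_def by (intro restrict_ext) auto
    then show ?case using zero gr_elem_in_carrier[of 0 1] by simp
  next
    case (Suc j)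
    have "aadd gr (G j) (gr_elem (Suc j) (X (Suc j))) = G (Suc j)"
      unfolding gr_def gr_elem_def G_def calg.simps
      by (rule restrict_ext) (simp only: restrict_apply' coset_add, simp add: le_Suc_eq)
    with step[of "G j" "Suc j" "X (Suc j)"] Suc X[of "Suc j"] have "P (G (Suc j))" by auto
    moreover have "G (Suc j) \<in> acarrier gr"
      using X by (auto simp: G_def gr_def lcs_quot_def simp del: image_add_0)
    ultimately show ?case ..
  qed
  have "G nilindex = g"
  proof
    fix i show "G nilindex i = g i"
      using X[of i] g by (auto simp: G_def gr_def PiE_def extensional_def)
  qed
  with G[of nilindex] show ?thesis by auto
qed

section \<open>Gradations of maximum length\<close>

lemma gradation_sum_eq_zero:
  assumes V: "gradation V" and f: "\<And>i. f i \<in> V i" and 0: "(\<Sum>i | V i \<noteq> {0}. f i) = 0"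
  shows "f i = 0"
proof -
  have "\<exists>!f. (\<forall>i. f i \<in> V i) \<and> 0 = (\<Sum>i | V i \<noteq> {0}. f i)"
    using V unfolding gradation_def by blast
  moreover have "(\<forall>i. 0 \<in> V i) \<and> 0 = (\<Sum>i | V i \<noteq> {0}. 0::'a)"
    using V by (auto simp: gradation_def intro: subspace_0)
  ultimately have "f = (\<lambda>_. 0)"
    using f 0 by (metis (no_types, lifting))
  then show ?thesis by simp
qed

text \<open>Placing \<open>x\<close> in degree \<open>i\<close> and \<open>- x\<close> in degree
  \<open>j\<close> decomposes zero.\<close>

lemma gradation_inter:
  assumes V: "gradation V" and "i \<noteq> j" "x \<in> V i" "x \<in> V j"
  shows "x = 0"
proof (rule ccontr)
  assume "x \<noteq> 0"
  let ?I = "{i. V i \<noteq> {0}}"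
  define f where "f q = (if q = i then x else 0) - (if q = j then x else 0)" for q
  have fin: "finite ?I" and sub: "\<And>i. subspace (V i)" using V by (auto simp: gradation_def)
  have "i \<in> ?I" "j \<in> ?I" using assms \<open>x \<noteq> 0\<close> by auto
  then have "(\<Sum>q\<in>?I. f q) = 0" using fin by (simp add: f_def sum_subtractf sum.delta)
  moreover have "f q \<in> V q" for q
    using assms(2-4) subspace_0[OF sub] subspace_neg[OF sub] by (auto simp: f_def)
  ultimately have "f i = 0" using gradation_sum_eq_zero[OF V] by blast
  then show False using \<open>x \<noteq> 0\<close> \<open>i \<noteq> j\<close> by (simp add: f_def)
qed

text \<open>The support has \<open>dim UNIV\<close> elements, so one nonzero vector from each
  component, with \<open>y\<close> chosen in degree \<open>i\<close>, forms a basis. Comparing the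
  components of degree \<open>i\<close> in the expansion of \<open>x\<close> leaves a multiple of
  \<open>y\<close>.\<close>

lemma max_length_proportional:
  assumes "connected_gradation V (dim UNIV)" "x \<in> V i" "y \<in> V i" "y \<noteq> 0"
  shows "\<exists>c. x = c *s y"
proof -
  let ?I = "{i. V i \<noteq> {0}}"
  from assms(1) have V: "gradation V" and card: "card ?I = dim UNIV"
    by (auto simp: connected_gradation_def)
  have fin: "finite ?I" and sub: "\<And>i. subspace (V i)" using V by (auto simp: gradation_def)
  have iI: "i \<in> ?I" using assms(3,4) by auto
  have "\<forall>j\<in>?I. \<exists>w. w \<in> V j \<and> w \<noteq> 0 \<and> (j = i \<longrightarrow> w = y)"
    using assms(3,4) subspace_0[OF sub] by (metis (mono_tags, lifting) mem_Collect_eq subsetI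
      subset_singletonD empty_iff singletonI)
  then obtain b where b: "\<And>j. j \<in> ?I \<Longrightarrow> b j \<in> V j \<and> b j \<noteq> 0 \<and> (j = i \<longrightarrow> b j = y)" by metis
  have zero: "c j = 0" if "(\<Sum>j\<in>?I. c j *s b j) = 0" "j \<in> ?I" for c j
  proof -
    define f where "f j = (if j \<in> ?I then c j *s b j else 0)" for j
    have "(\<Sum>j\<in>?I. f j) = 0" using that by (simp add: f_def)
    moreover have "f j \<in> V j" for j
      using b[of j] by (auto simp: f_def intro: subspace_0 subspace_scale sub)
    ultimately have "f j = 0" using gradation_sum_eq_zero[OF V] by blast
    then show ?thesis using that b[of j] by (simp add: f_def)
  qed
  have inj: "inj_on b ?I"
  proof (rule inj_onI)
    fix j k assume jk: "j \<in> ?I" "k \<in> ?I" "b j = b k"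
    then show "j = k" using gradation_inter[OF V, of j k "b j"] b[of j] b[of k] by auto
  qed
  have indep: "independent (b ` ?I)"
  proof (rule independent_if_scalars_zero)
    fix c w assume s: "(\<Sum>w\<in>b ` ?I. c w *s w) = 0" and w: "w \<in> b ` ?I"
    have "(\<Sum>j\<in>?I. c (b j) *s b j) = 0" using s by (simp add: sum.reindex[OF inj])
    with zero[of "\<lambda>j. c (b j)"] w show "c w = 0" by auto
  qed (use fin in auto)
  have "x \<in> span (b ` ?I)"
  proof (rule ccontr)
    assume x: "x \<notin> span (b ` ?I)"
    obtain C where C: "independent C" "UNIV \<subseteq> span C" "card C = dim UNIV"
      by (rule basis_exists[of UNIV])
    obtain D where D: "finite D" "span D = UNIV" using fin_dim by blast
    have finC: "finite C" using independent_span_bound[OF D(1) C(1)] D by auto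
    have "independent (insert x (b ` ?I))" using indep x by (rule independent_insertI[rotated])
    from independent_span_bound[OF finC this] C
    have "card (insert x (b ` ?I)) \<le> dim UNIV" by auto
    moreover have "x \<notin> b ` ?I" using x by (metis span_base)
    ultimately show False using card fin card_image[OF inj] by simp
  qed
  then obtain c where c: "x = (\<Sum>w\<in>b ` ?I. c w *s w)"
    using fin by (auto simp: span_finite)
  define g where "g j = (if j \<in> ?I then c (b j) *s b j - (if j = i then x else 0) else 0)" for j
  have "(\<Sum>j\<in>?I. g j) = (\<Sum>j\<in>?I. c (b j) *s b j) - (\<Sum>j\<in>?I. if j = i then x else 0)"
    by (simp add: g_def sum_subtractf)
  also have "\<dots> = 0"
    using c iI fin by (simp add: sum.reindex[OF inj] sum.delta)
  finally have "(\<Sum>j\<in>?I. g j) = 0" .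
  moreover have "g j \<in> V j" for j
    using b[of j] assms(2) subspace_0[OF sub]
    by (auto simp: g_def intro!: subspace_0 subspace_scale subspace_diff sub)
  ultimately have "g i = 0" using gradation_sum_eq_zero[OF V] by blast
  then show ?thesis using iI b[OF iI] by (auto simp: g_def)
qed

end

section \<open>Structure constants\<close>

text \<open>Degrees for which the brackets of both families are homogeneous; the generators
  \<open>BX 0\<close> and \<open>BX 1\<close> share degree 1.\<close>

fun tau_deg :: "nat \<Rightarrow> nat \<Rightarrow> (nat \<Rightarrow> nat) \<Rightarrow> tau_idx \<Rightarrow> nat" where
  "tau_deg p m r (BX i) = (if i = 0 then 1 else i)"
| "tau_deg p m r (BY j) = (if j = p - 1 then m else r j)"

text \<open>Odd numbers that increase strictly grow by at least 2 at each step.\<close>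

lemma admissible_lower:
  assumes "admissible p r m" "1 \<le> j" "j \<le> p - 2"
  shows "2 * j + 1 \<le> r j"
  using assms(2,3)
proof (induction j rule: dec_induct)
  case base
  then show ?case using assms(1) by (simp add: admissible_def)
next
  case (step j)
  then have "r j < r (Suc j)" "odd (r j)" "odd (r (Suc j))" "2 * j + 1 \<le> r j"
    using assms(1) by (auto simp: admissible_def)
  then show ?case by presburger
qed

lemma admissible_less:
  assumes "admissible p r m" "1 \<le> i" "i < j" "j \<le> p - 2"
  shows "r i < r j"
  using assms(3)[THEN Suc_leI] assms(4)
proof (induction j rule: dec_induct)
  case base
  then show ?case using assms(1,2) by (auto simp: admissible_def)
next
  case (step j)
  then have "r j < r (Suc j)" using assms(1,2) by (auto simp: admissible_def)
  with step show ?case by auto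
qed

lemma admissible_upper:
  assumes "admissible p r m" "1 \<le> j" "j \<le> p - 2"
  shows "r j + 2 \<le> m"
proof -
  have "r j \<le> r (p - 2)"
    using admissible_less[OF assms(1,2), of "p - 2"] assms(3) by (cases "j = p - 2") auto
  moreover have "r (p - 2) < m" "odd (r (p - 2))" "odd m"
    using assms by (auto simp: admissible_def)
  ultimately show ?thesis by presburger
qed

text \<open>The \<open>p - 2\<close> odd numbers \<open>r j\<close> lie between 3 and
  \<open>m - 2\<close>. For \<open>p \<ge> 4\<close> this yields \<open>m \<ge> 7\<close>.\<close>

lemma admissible_le:
  assumes "admissible p r m" "p \<ge> 3"
  shows "2 * p \<le> m + 1"
  using admissible_lower[OF assms(1), of "p - 2"] admissible_upper[OF assms(1), of "p - 2"] assms(2)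
  by arith

text \<open>
  With \<open>m = n - p - 1\<close> for \<open>tau1\<close> and \<open>m = n - p - 2\<close> for \<open>tau2\<close>, both families have the same
  brackets with the two generators, and no other brackets are needed.
\<close>

locale tau_structure =
  fixes n p m :: nat and r :: "nat \<Rightarrow> nat" and t :: "tau_idx \<Rightarrow> tau_idx \<Rightarrow> tau_idx \<Rightarrow> complex"
  assumes p: "p \<ge> 4" and top: "n - p = m + 1 \<or> n - p = m + 2"
    and adm: "admissible p r m"
    and table_graded: "\<lbrakk>a \<in> tau_basis n p; b \<in> tau_basis n p; l \<in> tau_basis n p; t a b l \<noteq> 0\<rbrakk> \<Longrightarrow>
      tau_deg p m r a + tau_deg p m r b = tau_deg p m r l"
    and br_X0_X1: "t (BX 0) (BX 1) l - t (BX 1) (BX 0) l = kd (BX 2) l"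
    and br_Xk_X0: "2 \<le> k \<Longrightarrow> k \<le> n - p \<Longrightarrow>
      t (BX k) (BX 0) l - t (BX 0) (BX k) l = (if k < n - p then - kd (BX (Suc k)) l else 0)"
    and br_Xk_X1: "2 \<le> k \<Longrightarrow> k \<le> n - p \<Longrightarrow>
      t (BX k) (BX 1) l - t (BX 1) (BX k) l =
        - (\<Sum>j\<in>{1..p - 2}. if Suc k = r j then kd (BY j) l else 0)
        - (if Suc k = m then kd (BX m) l + kd (BY (p - 1)) l else 0)
        - (if k = m then (of_nat m - 1) / 2 * kd (BX (Suc m)) l else 0)"
    and br_Y_X0: "t (BY j) (BX 0) l - t (BX 0) (BY j) l = 0"
    and br_Y_X1: "t (BY j) (BX 1) l - t (BX 1) (BY j) l =
        (if j = p - 1 then (of_nat m - 1) / 2 * kd (BX (Suc m)) l else 0)"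

text \<open>Pairs of \<open>BX\<close> are listed with the smaller index first, so for
  \<open>k \<ge> 2\<close> right multiplication of \<open>BX k\<close> by \<open>BX 0\<close> or
  \<open>BX 1\<close> is minus the corresponding row of the table.\<close>

lemma tau_structure_tau1:
  assumes p: "p \<ge> 4" and adm: "admissible p r (n - p - 1)"
  shows "tau_structure n p (n - p - 1) r (tau1_table n p r)"
proof -
  define N where "N = n - p"
  have r: "3 \<le> r j" "r j + 2 \<le> N - 1" if "j \<in> {1..p - 2}" for j
    using admissible_lower[OF adm, of j] admissible_upper[OF adm, of j] that by (auto simp: N_def)
  have N: "N \<ge> 8" using admissible_le[OF adm] p by (simp add: N_def)
  have np: "of_nat n = (of_nat p + of_nat N :: complex)" using N by (simp add: N_def flip: of_nat_add)
  have Nm: "n - p = N" by (simp add: N_def)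
  have add0: "x = 0 \<Longrightarrow> y = 0 \<Longrightarrow> x + y = 0" for x y :: complex by simp
  let ?d = "tau_deg p (N - 1) r"
  have graded: "tau1_table n p r a b l = 0" if d: "?d a + ?d b \<noteq> ?d l" for a b l
  proof (cases a)
    case a: (BX i)
    show ?thesis
    proof (cases b)
      case b: (BX k)
      have "(\<Sum>j\<in>{1..p - 2}. if 1 \<le> i \<and> 2 * i \<le> r j - 1 \<and> k = r j - i
        then (- 1) ^ (i - 1) * kd (BY j) l else 0) = 0"
      proof (rule sum.neutral, rule ballI)
        fix j assume j: "j \<in> {1..p - 2}"
        with r[OF j] p d show "(if 1 \<le> i \<and> 2 * i \<le> r j - 1 \<and> k = r j - i
          then (- 1) ^ (i - 1) * kd (BY j) l else 0) = 0"
          by (auto simp: a b kd_def split: if_splits)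
      qed
      then show ?thesis
        unfolding a b tau1_table.simps Nm
        by (intro add0) (use d N in \<open>auto simp: a b kd_def split: if_splits\<close>)
    next
      case (BY j)
      then show ?thesis using d N by (auto simp: a Nm kd_def split: if_splits)
    qed
  qed simp
  have Xk_X0: "tau1_table n p r (BX k) (BX 0) l = 0" if "1 \<le> k" for k l
  proof -
    have "(\<Sum>j\<in>{1..p - 2}. if 1 \<le> k \<and> 2 * k \<le> r j - 1 \<and> 0 = r j - k
        then (- 1) ^ (k - 1) * kd (BY j) l else 0) = 0"
      using that by (intro sum.neutral) auto
    then show ?thesis
      unfolding tau1_table.simps Nm by (intro add0) (use that N in auto)
  qed
  have Xk_X1: "tau1_table n p r (BX k) (BX 1) l = 0" if "2 \<le> k" for k l
  proof -
    have "(\<Sum>j\<in>{1..p - 2}. if 1 \<le> k \<and> 2 * k \<le> r j - 1 \<and> 1 = r j - k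
        then (- 1) ^ (k - 1) * kd (BY j) l else 0) = 0"
      using that by (intro sum.neutral) auto
    then show ?thesis
      unfolding tau1_table.simps Nm by (intro add0) (use that N in auto)
  qed
  have X1_Xk: "tau1_table n p r (BX 1) (BX k) l =
        (\<Sum>j\<in>{1..p - 2}. if Suc k = r j then kd (BY j) l else 0)
        + (if Suc k = N - 1 then kd (BX (N - 1)) l + kd (BY (p - 1)) l else 0)
        + (if k = N - 1 then (of_nat (N - 1) - 1) / 2 * kd (BX (Suc (N - 1))) l else 0)"
    if "2 \<le> k" for k l
  proof -
    have "(\<Sum>j\<in>{1..p - 2}. if 1 \<le> (1::nat) \<and> 2 * 1 \<le> r j - 1 \<and> k = r j - 1
        then (- 1) ^ (1 - 1) * kd (BY j) l else 0) =
      (\<Sum>j\<in>{1..p - 2}. if Suc k = r j then kd (BY j) l else 0)"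
      using r that by (intro sum.cong) fastforce+
    \<comment> \<open>The substitution replaces the truncated differences in \<open>N\<close> by
      sums.\<close>
    moreover obtain M where M: "N = M + 6" "M \<ge> 2" 
      using N by (intro that[of "N - 6"]) auto
    ultimately show ?thesis using that unfolding tau1_table.simps Nm M
      by (simp add: np M add.commute[of M])
  qed
  show ?thesis
  proof (unfold_locales, goal_cases)
    case 1
    show ?case by fact
  next
    case 2
    show ?case unfolding Nm using N by arith
  next
    case 3
    show ?case by fact
  next
    case (4 a b l)
    then show ?case using graded[of a b l] unfolding Nm by blast
  next
    case (5 l)
    show ?case using N Xk_X0[of 1 l] by (simp add: Nm numeral_2_eq_2)
  next
    case (6 k l)
    then show ?case using Xk_X0[of k l] N by (auto simp: Nm)
  next
    case (7 k l)
    then show ?case unfolding Nm using Xk_X1[of k l] X1_Xk[of k l] by simp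
  next
    case (8 j l)
    show ?case by simp
  next
    case (9 j l)
    show ?case using N by (simp add: Nm np field_simps of_nat_diff)
  qed
qed

text \<open>In degree \<open>n - p = m + 2\<close> the only listed bracket with a generator is that
  of \<open>BX 0\<close> and \<open>BX (m + 1)\<close>; brackets with generators in lower degrees
  follow the pattern of \<open>tau1_table\<close>, with \<open>m\<close> in the same role.\<close>

lemma tau_structure_tau2:
  assumes p: "p \<ge> 4" and adm: "admissible p r (n - p - 2)"
  shows "tau_structure n p (n - p - 2) r (tau2_table n p r)"
proof -
  define N where "N = n - p"
  have r: "3 \<le> r j" "r j + 2 \<le> N - 2" if "j \<in> {1..p - 2}" for j
    using admissible_lower[OF adm, of j] admissible_upper[OF adm, of j] that by (auto simp: N_def)
  have N: "N \<ge> 8" using admissible_le[OF adm] p by (simp add: N_def)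
  have np: "of_nat n = (of_nat p + of_nat N :: complex)" using N by (simp add: N_def flip: of_nat_add)
  have Nm: "n - p = N" by (simp add: N_def)
  have add0: "x = 0 \<Longrightarrow> y = 0 \<Longrightarrow> x + y = 0" for x y :: complex by simp
  let ?d = "tau_deg p (N - 2) r"
  have graded: "tau2_table n p r a b l = 0" if d: "?d a + ?d b \<noteq> ?d l" for a b l
  proof (cases a)
    case a: (BX i)
    show ?thesis
    proof (cases b)
      case b: (BX k)
      have "(\<Sum>j\<in>{1..p - 2}. if 1 \<le> i \<and> 2 * i \<le> r j - 1 \<and> k = r j - i
        then (- 1) ^ (i - 1) * kd (BY j) l else 0) = 0"
      proof (rule sum.neutral, rule ballI)
        fix j assume j: "j \<in> {1..p - 2}"
        with r[OF j] p d show "(if 1 \<le> i \<and> 2 * i \<le> r j - 1 \<and> k = r j - i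
          then (- 1) ^ (i - 1) * kd (BY j) l else 0) = 0"
          by (auto simp: a b kd_def split: if_splits)
      qed
      then show ?thesis
        unfolding a b tau2_table.simps Nm
        by (intro add0) (use d N in \<open>auto simp: a b kd_def split: if_splits\<close>)
    next
      case (BY j)
      then show ?thesis using d N by (auto simp: a Nm kd_def split: if_splits)
    qed
  qed simp
  have Xk_X0: "tau2_table n p r (BX k) (BX 0) l = 0" if "1 \<le> k" for k l
  proof -
    have "(\<Sum>j\<in>{1..p - 2}. if 1 \<le> k \<and> 2 * k \<le> r j - 1 \<and> 0 = r j - k
        then (- 1) ^ (k - 1) * kd (BY j) l else 0) = 0"
      using that by (intro sum.neutral) auto
    then show ?thesis
      unfolding tau2_table.simps Nm by (intro add0) (use that N in auto)
  qed
  have Xk_X1: "tau2_table n p r (BX k) (BX 1) l = 0" if "2 \<le> k" for k l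
  proof -
    have "(\<Sum>j\<in>{1..p - 2}. if 1 \<le> k \<and> 2 * k \<le> r j - 1 \<and> 1 = r j - k
        then (- 1) ^ (k - 1) * kd (BY j) l else 0) = 0"
      using that by (intro sum.neutral) auto
    then show ?thesis
      unfolding tau2_table.simps Nm by (intro add0) (use that N in auto)
  qed
  have X1_Xk: "tau2_table n p r (BX 1) (BX k) l =
        (\<Sum>j\<in>{1..p - 2}. if Suc k = r j then kd (BY j) l else 0)
        + (if Suc k = N - 2 then kd (BX (N - 2)) l + kd (BY (p - 1)) l else 0)
        + (if k = N - 2 then (of_nat (N - 2) - 1) / 2 * kd (BX (Suc (N - 2))) l else 0)"
    if "2 \<le> k" for k l
  proof -
    have "(\<Sum>j\<in>{1..p - 2}. if 1 \<le> (1::nat) \<and> 2 * 1 \<le> r j - 1 \<and> k = r j - 1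
        then (- 1) ^ (1 - 1) * kd (BY j) l else 0) =
      (\<Sum>j\<in>{1..p - 2}. if Suc k = r j then kd (BY j) l else 0)"
      using r that by (intro sum.cong) fastforce+
    moreover obtain M where M: "N = M + 6" "M \<ge> 2" 
      using N by (intro that[of "N - 6"]) auto
    ultimately show ?thesis using that unfolding tau2_table.simps Nm M
      by (simp add: np M add.commute[of M])
  qed
  show ?thesis
  proof (unfold_locales, goal_cases)
    case 1
    show ?case by fact
  next
    case 2
    show ?case unfolding Nm using N by arith
  next
    case 3
    show ?case by fact
  next
    case (4 a b l)
    then show ?case using graded[of a b l] unfolding Nm by blast
  next
    case (5 l)
    show ?case using N Xk_X0[of 1 l] by (simp add: Nm numeral_2_eq_2)
  next
    case (6 k l)
    then show ?case using Xk_X0[of k l] N by (auto simp: Nm)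
  next
    case (7 k l)
    then show ?case unfolding Nm using Xk_X1[of k l] X1_Xk[of k l] by simp
  next
    case (8 j l)
    show ?case by simp
  next
    case (9 j l)
    show ?case using N by (simp add: Nm np field_simps of_nat_diff)
  qed
qed

section \<open>Weights\<close>

lemma tau_basis_memI:
  "k \<le> n - p \<Longrightarrow> BX k \<in> tau_basis n p"
  "1 \<le> j \<Longrightarrow> j \<le> p - 1 \<Longrightarrow> BY j \<in> tau_basis n p"
  by (auto simp: tau_basis_def)

lemma finite_tau_basis: "finite (tau_basis n p)"
  by (simp add: tau_basis_def)

lemma card_tau_basis:
  assumes "1 \<le> p" "p \<le> n"
  shows "card (tau_basis n p) = n"
proof -
  have "card (tau_basis n p) = card (BX ` {0..n - p}) + card (BY ` {1..p - 1})"
    unfolding tau_basis_def by (rule card_Un_disjoint) auto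
  also have "\<dots> = n" using assms by (simp add: card_image inj_on_def)
  finally show ?thesis by blast
qed

text \<open>For \<open>a = 0\<close> or \<open>a = 1\<close> two weights coincide or an integer is
  missed. For \<open>a \<ge> 2\<close> the progression \<open>b + i * a\<close> outgrows the
  interval, except for \<open>p = 4\<close>, \<open>m = 7\<close>, \<open>n = 13\<close>,
  \<open>a = 2\<close>, where again two weights coincide.\<close>

lemma weights_not_interval_nonneg:
  fixes wt :: "tau_idx \<Rightarrow> int" and a b :: int
  assumes p: "p \<ge> 4" and adm: "admissible p r m" and top: "n - p = m + 1 \<or> n - p = m + 2"
    and inj: "inj_on wt (tau_basis n p)"
    and img: "wt ` tau_basis n p = {c..c + int n - 1}"
    and X0: "wt (BX 0) = a"
    and X: "\<And>k. 1 \<le> k \<Longrightarrow> k \<le> m \<Longrightarrow> wt (BX k) = b + (int k - 1) * a"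
    and Xtop: "\<And>k. m < k \<Longrightarrow> wt (BX k) = 2 * b + (int k - 2) * a"
    and Y: "\<And>j. 1 \<le> j \<Longrightarrow> j \<le> p - 2 \<Longrightarrow> wt (BY j) = 2 * b + (int (r j) - 2) * a"
    and Ym: "wt (BY (p - 1)) = 2 * b + (int m - 2) * a"
    and a: "a \<ge> 0"
  shows False
proof -
  have m: "2 * p \<le> m + 1" using admissible_le[OF adm] p by simp
  have n: "n = p + m + 1 \<or> n = p + m + 2" using top by arith
  have ne: "wt l \<noteq> wt l'" if "l \<in> tau_basis n p" "l' \<in> tau_basis n p" "l \<noteq> l'" for l l'
    using inj_onD[OF inj _ that(1,2)] that(3) by blast
  have B: "k \<le> m + 1 \<Longrightarrow> BX k \<in> tau_basis n p" "1 \<le> j \<Longrightarrow> j \<le> p - 1 \<Longrightarrow> BY j \<in> tau_basis n p" for k j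
    using top by (auto intro!: tau_basis_memI)
  have in_img: "c \<le> wt l \<and> wt l \<le> c + int n - 1" if "l \<in> tau_basis n p" for l
    using img that by auto
  have r1: "3 \<le> r 1" "odd (r 1)" using adm p by (auto simp: admissible_def)
  have r1m: "r 1 + 2 \<le> m" using admissible_upper[OF adm, of 1] p by simp
  have "a \<noteq> 0" using ne[of "BX 1" "BX 2"] X[of 1] X[of 2] B m p by auto
  moreover have "a \<noteq> 1"
  proof
    assume a1: "a = 1"
    \<comment> \<open>Otherwise 1, the weight of \<open>BX 0\<close>, also occurs in the progression
      from \<open>b\<close> to \<open>b + m - 1\<close>.\<close>
    have "b \<ge> 2 \<or> b + int m - 1 \<le> 0"
    proof (rule ccontr)
      assume *: "\<not> ?thesis"
      let ?k = "nat (2 - b)"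
      have "wt (BX ?k) = wt (BX 0)" using X[of ?k] X0 a1 * by auto
      then show False using ne[of "BX ?k" "BX 0"] B[of ?k] B[of 0] * by auto
    qed
    then show False
    proof
      assume b: "b \<ge> 2"
      have "b = 2"
      proof (rule ccontr)
        assume b2: "b \<noteq> 2"
        \<comment> \<open>The interval contains 1 and \<open>b > 2\<close>, hence 2; but every
          weight other than that of \<open>BX 0\<close> is at least \<open>b\<close>.\<close>
        have "2 \<in> wt ` tau_basis n p"
          using in_img[of "BX 0"] in_img[of "BX 1"] X0 X[of 1] B[of 0] B[of 1] a1 b b2 m p
          unfolding img by auto
        then obtain l where l: "l \<in> tau_basis n p" "wt l = 2" by auto
        show False
        proof (cases l)
          case (BX k)
          then show ?thesis using l X0 X[of k] Xtop[of k] a1 b b2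
            by (cases "k = 0"; cases "k \<le> m") auto
        next
          case (BY j)
          with l have "j = p - 1 \<or> 1 \<le> j \<and> j \<le> p - 2" by (auto simp: tau_basis_def)
          with BY show ?thesis using l Y[of j] Ym a1 b b2 admissible_lower[OF adm, of j] m p
            by auto
        qed
      qed
      then have "wt (BY 1) = wt (BX (r 1 + 1))" using Y[of 1] X[of "r 1 + 1"] a1 p r1 r1m by simp
      then show False using ne[of "BY 1" "BX (r 1 + 1)"] B(2)[of 1] B(1)[of "r 1 + 1"] p r1m by simp
    next
      assume b: "b + int m - 1 \<le> 0"
      show False
      proof (cases "b + int m - 1 = 0")
        case True
        then have "wt (BX (Suc m)) = wt (BX 1)" using Xtop[of "Suc m"] X[of 1] a1 m p by simp
        then show False using ne[of "BX (Suc m)" "BX 1"] B(1)[of "Suc m"] B(1)[of 1] m p by auto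
      next
        case False
        \<comment> \<open>The interval contains \<open>b < 0\<close> and 1, hence 0; but every
          weight other than that of \<open>BX 0\<close> is at most \<open>b + m - 1\<close> or
          \<open>2 * b + m\<close>, both negative.\<close>
        have "0 \<in> wt ` tau_basis n p"
          using in_img[of "BX 0"] in_img[of "BX 1"] X0 X[of 1] B[of 0] B[of 1] a1 b m p
          unfolding img by auto
        then obtain l where l: "l \<in> tau_basis n p" "wt l = 0" by auto
        show False
        proof (cases l)
          case (BX k)
          with l top have "k \<le> m + 2" by (auto simp: tau_basis_def)
          with BX show ?thesis using l X0 X[of k] Xtop[of k] a1 b False m p
            by (cases "k = 0"; cases "k \<le> m") auto
        next
          case (BY j)
          with l have "j = p - 1 \<or> 1 \<le> j \<and> j \<le> p - 2" by (auto simp: tau_basis_def)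
          with BY show ?thesis using l Y[of j] Ym a1 b False admissible_upper[OF adm, of j] m p
            by auto
        qed
      qed
    qed
  qed
  ultimately have a2: "a \<ge> 2" using a by simp
  \<comment> \<open>The \<open>m\<close> terms of the progression lie in an interval of
    \<open>n\<close> integers. For \<open>a \<ge> 2\<close> this gives \<open>m \<le> p + 3\<close>,
    and with \<open>2 * p \<le> m + 1\<close> only \<open>p = 4\<close>, \<open>m = 7\<close>
    remains.\<close>
  have span: "(int m - 1) * a \<le> int n - 1"
    using in_img[of "BX 1"] in_img[of "BX m"] X[of 1] X[of m] B(1)[of 1] B(1)[of m] m p by auto
  have "(int m - 1) * 2 \<le> (int m - 1) * a" using a2 m p by (intro mult_left_mono) auto
  with span have "int m \<le> int p + 3" using n by auto
  then have pm: "p = 4" "m = 7" using m p by auto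
  then have "n = 13" using span a2 n by auto
  then have N: "n - p = m + 2" using pm by simp
  have a: "a = 2" using span a2 pm \<open>n = 13\<close> by simp
  have "r 1 \<noteq> 5"
    using admissible_less[OF adm, of 1 2] admissible_upper[OF adm, of 2] pm by auto
  then have r1': "r 1 = 3" using r1 r1m pm by presburger
  \<comment> \<open>The 7 terms of the progression with difference 2 reach from one end of the 13
    integers to the other.\<close>
  have "c = b" using in_img[of "BX 1"] in_img[of "BX m"] X[of 1] X[of m] B(1)[of 1] B(1)[of m]
    pm a \<open>n = 13\<close> by auto
  moreover have "wt (BY 1) = 2 * b + 2" using Y[of 1] r1' pm a by simp
  moreover have "wt (BX (m + 2)) = 2 * b + 14" using Xtop[of "m + 2"] pm a by simp
  \<comment> \<open>The weights of \<open>BY 1\<close> and \<open>BX (m + 2)\<close> also differ by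
    12, so \<open>BY 1\<close> sits at the left end, as \<open>BX 1\<close> does.\<close>
  ultimately have "wt (BY 1) = wt (BX 1)"
    using in_img[of "BY 1"] in_img[of "BX (m + 2)"] B(2)[of 1] tau_basis_memI(1)[of "m + 2" n p]
      N pm X[of 1] \<open>n = 13\<close> by simp
  then show False using ne[of "BY 1" "BX 1"] B(2)[of 1] B(1)[of 1] p by simp
qed

text \<open>Negating all weights negates \<open>a\<close> and \<open>b\<close> and again gives an
  interval.\<close>

lemma weights_not_interval:
  fixes wt :: "tau_idx \<Rightarrow> int" and a b :: int
  assumes p: "p \<ge> 4" and adm: "admissible p r m" and top: "n - p = m + 1 \<or> n - p = m + 2"
    and inj: "inj_on wt (tau_basis n p)"
    and img: "wt ` tau_basis n p = {c..c + int n - 1}"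
    and X0: "wt (BX 0) = a"
    and X: "\<And>k. 1 \<le> k \<Longrightarrow> k \<le> m \<Longrightarrow> wt (BX k) = b + (int k - 1) * a"
    and Xtop: "\<And>k. m < k \<Longrightarrow> wt (BX k) = 2 * b + (int k - 2) * a"
    and Y: "\<And>j. 1 \<le> j \<Longrightarrow> j \<le> p - 2 \<Longrightarrow> wt (BY j) = 2 * b + (int (r j) - 2) * a"
    and Ym: "wt (BY (p - 1)) = 2 * b + (int m - 2) * a"
  shows False
proof (cases "a \<ge> 0")
  case True
  with weights_not_interval_nonneg[OF assms] show ?thesis by blast
next
  case False
  have "(\<lambda>l. - wt l) ` tau_basis n p = uminus ` {c..c + int n - 1}"
    unfolding img[symmetric] by (simp add: image_image)
  also have "\<dots> = {- (c + int n - 1)..- (c + int n - 1) + int n - 1}" by simp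
  finally have "(\<lambda>l. - wt l) ` tau_basis n p = \<dots>" .
  from weights_not_interval_nonneg[OF p adm top _ this, of "- a" "- b"] inj X0 X Xtop Y Ym False
  show ?thesis by (simp add: inj_on_def)
qed

section \<open>Leading terms\<close>

context tau_structure
begin

abbreviation "bas \<equiv> tau_basis n p"
abbreviation "deg \<equiv> tau_deg p m r"
abbreviation "alg \<equiv> antisym_alg bas t"

lemma m_ge: "m \<ge> 7"
  using admissible_le[OF adm] p by simp

lemma X_mem: "k \<le> m + 1 \<Longrightarrow> BX k \<in> bas" and Y_mem: "1 \<le> j \<Longrightarrow> j \<le> p - 1 \<Longrightarrow> BY j \<in> bas"
  using top by (auto intro!: tau_basis_memI)

lemma bas_cases:
  assumes "l \<in> bas"
  obtains k where "l = BX k" "k \<le> n - p"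
    | j where "l = BY j" "1 \<le> j" "j \<le> p - 2" "j \<noteq> p - 1" "3 \<le> r j" "r j + 2 \<le> m"
    | "l = BY (p - 1)"
proof -
  have "(\<exists>k. l = BX k \<and> k \<le> n - p) \<or> (\<exists>j. l = BY j \<and> 1 \<le> j \<and> j \<le> p - 2 \<and> j \<noteq> p - 1) \<or> l = BY (p - 1)"
    using assms by (auto simp: tau_basis_def)
  moreover have "3 \<le> r j \<and> r j + 2 \<le> m" if "1 \<le> j" "j \<le> p - 2" for j
    using admissible_lower[OF adm that] admissible_upper[OF adm that] that by simp
  ultimately show thesis using that by blast
qed

lemma deg_pos: "l \<in> bas \<Longrightarrow> 1 \<le> deg l"
  using m_ge by (elim bas_cases) auto

lemma deg_le: "l \<in> bas \<Longrightarrow> deg l \<le> n - p"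
  using m_ge top by (elim bas_cases) auto

lemma deg_eq_1: "l \<in> bas \<Longrightarrow> deg l = 1 \<longleftrightarrow> l = BX 0 \<or> l = BX 1"
  using m_ge by (elim bas_cases) auto

lemma deg_eq_top: "l \<in> bas \<Longrightarrow> deg l = n - p \<Longrightarrow> l = BX (n - p)"
  using m_ge top by (elim bas_cases) (auto split: if_splits)

definition filt :: "nat \<Rightarrow> (tau_idx \<Rightarrow> complex) set" where
  "filt k = {f. \<forall>l\<in>bas. deg l < k \<longrightarrow> f l = 0}"

lemma table_zero:
  assumes "a \<in> bas" "b \<in> bas" "l \<in> bas" "deg a + deg b \<noteq> deg l"
  shows "t a b l = 0" "t b a l = 0"
  using table_graded[of a b l] table_graded[of b a l] assms by auto

lemma br_filt:
  assumes f: "f \<in> filt k"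
  shows "abr alg f g \<in> filt (Suc k)"
proof -
  have "f a * g b * (t a b l - t b a l) = 0"
    if "a \<in> bas" "b \<in> bas" "l \<in> bas" "deg l < Suc k" for a b l
  proof (cases "deg a < k")
    case True
    then show ?thesis using f that by (auto simp: filt_def)
  next
    case False
    then show ?thesis using table_zero[of a b l] deg_pos[of b] that by auto
  qed
  then show ?thesis by (simp add: filt_def antisym_alg_def sum.neutral)
qed

text \<open>Since \<open>f\<close> starts in degree \<open>k\<close>, only the degree one part of
  \<open>w\<close>, on \<open>BX 0\<close> and \<open>BX 1\<close>, reaches degree
  \<open>Suc k\<close>.\<close>

lemma br_sum_X01:
  assumes "f \<in> filt k" "l \<in> bas" "deg l = Suc k"
  shows "abr alg f w l = (\<Sum>a\<in>bas. f a *
    (w (BX 0) * (t a (BX 0) l - t (BX 0) a l) + w (BX 1) * (t a (BX 1) l - t (BX 1) a l)))"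
proof -
  have "(\<Sum>b\<in>bas. f a * w b * (t a b l - t b a l)) = f a *
    (w (BX 0) * (t a (BX 0) l - t (BX 0) a l) + w (BX 1) * (t a (BX 1) l - t (BX 1) a l))"
    if a: "a \<in> bas" for a
  proof (cases "f a = 0")
    case False
    then have "k \<le> deg a" using assms(1) a by (auto simp: filt_def not_le[symmetric])
    then have "(\<Sum>b\<in>bas. f a * w b * (t a b l - t b a l)) =
        (\<Sum>b\<in>{BX 0, BX 1}. f a * w b * (t a b l - t b a l))"
    proof (intro sum.mono_neutral_right ballI)
      fix b assume b: "b \<in> bas - {BX 0, BX 1}"
      then have "deg b \<ge> 2" using deg_pos[of b] deg_eq_1[of b] by fastforce
      then show "f a * w b * (t a b l - t b a l) = 0"
        using table_zero[of a b l] a b assms \<open>k \<le> deg a\<close> by auto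
    qed (use X_mem finite_tau_basis in auto)
    then show ?thesis by (simp add: algebra_simps)
  qed simp
  then show ?thesis by (simp add: antisym_alg_def)
qed

text \<open>This determinant of the degree one parts is what \<open>det\<close> later requires to be
  nonzero.\<close>

lemma br_coord_X2: "abr alg f w (BX 2) = f (BX 0) * w (BX 1) - f (BX 1) * w (BX 0)"
proof -
  have f: "f \<in> filt 1" using deg_pos by (fastforce simp: filt_def)
  have X2: "BX 2 \<in> bas" and deg2: "deg (BX 2) = Suc 1" using m_ge by (auto intro: X_mem)
  have "abr alg f w (BX 2) = (\<Sum>a\<in>{BX 0, BX 1}. f a *
    (w (BX 0) * (t a (BX 0) (BX 2) - t (BX 0) a (BX 2)) + w (BX 1) * (t a (BX 1) (BX 2) - t (BX 1) a (BX 2))))"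
    unfolding br_sum_X01[OF f X2 deg2]
  proof (intro sum.mono_neutral_right ballI)
    fix a assume a: "a \<in> bas - {BX 0, BX 1}"
    then have "deg a \<noteq> 1" using deg_eq_1[of a] by auto
    then show "f a * (w (BX 0) * (t a (BX 0) (BX 2) - t (BX 0) a (BX 2)) +
        w (BX 1) * (t a (BX 1) (BX 2) - t (BX 1) a (BX 2))) = 0"
      using table_zero[of a "BX 0" "BX 2"] table_zero[of a "BX 1" "BX 2"] a X2 X_mem by auto
  qed (use X_mem finite_tau_basis m_ge in auto)
  also have "\<dots> = f (BX 0) * w (BX 1) - f (BX 1) * w (BX 0)"
    using br_X0_X1[of "BX 2"] by (simp add: kd_def algebra_simps)
  finally show ?thesis .
qed

text \<open>In degree \<open>k \<ge> 2\<close> only \<open>BX k\<close> and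
  \<open>BY (p - 1)\<close> can have nonzero brackets with the generators; the latter enters for
  \<open>k = m\<close> alone.\<close>

lemma br_coord:
  assumes f: "f \<in> filt k" and k: "2 \<le> k" and l: "l \<in> bas" "deg l = Suc k"
  shows "abr alg f w l =
    - f (BX k) * (w (BX 0) * kd (BX (Suc k)) l
       + w (BX 1) * ((\<Sum>j\<in>{1..p - 2}. if Suc k = r j then kd (BY j) l else 0)
         + (if Suc k = m then kd (BX m) l + kd (BY (p - 1)) l else 0)
         + (if k = m then (of_nat m - 1) / 2 * kd (BX (Suc m)) l else 0)))
    + f (BY (p - 1)) * w (BX 1) * ((of_nat m - 1) / 2 * kd (BX (Suc m)) l)"
proof -
  have kN: "k < n - p" using deg_le[OF l(1)] l(2) by simp
  then have kB: "BX k \<in> bas" by (intro tau_basis_memI) auto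
  let ?g = "\<lambda>a. f a * (w (BX 0) * (t a (BX 0) l - t (BX 0) a l) +
      w (BX 1) * (t a (BX 1) l - t (BX 1) a l))"
  have "abr alg f w l = (\<Sum>a\<in>{BX k, BY (p - 1)}. ?g a)"
    unfolding br_sum_X01[OF f l]
  proof (intro sum.mono_neutral_right ballI)
    fix a assume a: "a \<in> bas - {BX k, BY (p - 1)}"
    show "?g a = 0"
    proof (cases a)
      case (BX i)
      then have "deg a \<noteq> k" using a k by auto
      then show ?thesis
        using table_zero[of a "BX 0" l] table_zero[of a "BX 1" l] a l X_mem by auto
    next
      case (BY j)
      then show ?thesis using br_Y_X0[of j l] br_Y_X1[of j l] a by simp
    qed
  qed (use kB Y_mem p finite_tau_basis in auto)
  also have "\<dots> = ?g (BX k) + ?g (BY (p - 1))" by simp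
  also have "\<dots> = - f (BX k) * (w (BX 0) * kd (BX (Suc k)) l
       + w (BX 1) * ((\<Sum>j\<in>{1..p - 2}. if Suc k = r j then kd (BY j) l else 0)
         + (if Suc k = m then kd (BX m) l + kd (BY (p - 1)) l else 0)
         + (if k = m then (of_nat m - 1) / 2 * kd (BX (Suc m)) l else 0)))
    + f (BY (p - 1)) * w (BX 1) * ((of_nat m - 1) / 2 * kd (BX (Suc m)) l)"
    unfolding br_Xk_X0[OF k less_imp_le[OF kN]] br_Xk_X1[OF k less_imp_le[OF kN]] br_Y_X0 br_Y_X1
    using kN by (simp add: algebra_simps)
  finally show ?thesis .
qed

lemma br_coord_X:
  assumes "f \<in> filt k" "2 \<le> k" "k < n - p"
  shows "abr alg f w (BX (Suc k)) = - (w (BX 0) * f (BX k)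
    + (if Suc k = m then w (BX 1) * f (BX k) else 0)
    + (if k = m then w (BX 1) * ((of_nat m - 1) / 2) * (f (BX m) - f (BY (p - 1))) else 0))"
proof -
  have X: "BX (Suc k) \<in> bas" "deg (BX (Suc k)) = Suc k"
    using assms by (auto intro!: tau_basis_memI)
  have "(\<Sum>j\<in>{1..p - 2}. if Suc k = r j then kd (BY j) (BX (Suc k)) else 0) = 0"
    by (intro sum.neutral) (auto simp: kd_def)
  moreover define q :: complex where "q = (of_nat m - 1) / 2"
  ultimately show ?thesis
    unfolding br_coord[OF assms(1,2) X, folded q_def] q_def[symmetric]
    by (auto simp: kd_def algebra_simps)
qed

lemma br_coord_Y:
  assumes "f \<in> filt k" "2 \<le> k" "1 \<le> j" "j \<le> p - 1" "deg (BY j) = Suc k"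
  shows "abr alg f w (BY j) = - w (BX 1) * f (BX k)"
proof -
  have *: "BY j \<in> bas" using assms by (intro Y_mem)
  show ?thesis
  proof (cases "j = p - 1")
    case True
    have "(\<Sum>j'\<in>{1..p - 2}. if Suc k = r j' then kd (BY j') (BY j) else 0) = 0"
      using True p by (intro sum.neutral) (auto simp: kd_def)
    then show ?thesis using br_coord[OF assms(1,2) * assms(5), of w] assms(5) True by (simp add: kd_def)
  next
    case False
    then have "r j = Suc k" "j \<in> {1..p - 2}" using assms by auto
    \<comment> \<open>This excludes the two exceptional terms of \<open>br_coord\<close>, for
      \<open>Suc k = m\<close> and \<open>k = m\<close>.\<close>
    then have "Suc k < m" using admissible_upper[OF adm, of j] by auto
    have "(\<Sum>j'\<in>{1..p - 2}. if Suc k = r j' then kd (BY j') (BY j) else 0) =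
        (\<Sum>j'\<in>{1..p - 2}. if j' = j then 1 else 0)"
      using \<open>r j = Suc k\<close> by (intro sum.cong) (auto simp: kd_def)
    also have "\<dots> = 1" using \<open>j \<in> _\<close> by (simp add: sum.delta)
    finally show ?thesis
      using br_coord[OF assms(1,2) * assms(5), of w] False \<open>Suc k < m\<close> by (simp add: kd_def)
  qed
qed

end

section \<open>Symbols of elements of the Leibniz algebra\<close>

locale leibniz_tau = leibniz_algebra scale br + tau_structure n p m r t
  for scale :: "complex \<Rightarrow> 'a::ab_group_add \<Rightarrow> 'a" (infixr "*s" 75)
    and br n p m r t +
  fixes h :: "(nat \<Rightarrow> 'a set) \<Rightarrow> tau_idx \<Rightarrow> complex"
  assumes nil: "nilpotent" and dim_n: "dim UNIV = n"
    and h_bij: "bij_betw h (acarrier gr) (acarrier alg)"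
    and h_add: "\<lbrakk>f \<in> acarrier gr; g \<in> acarrier gr\<rbrakk> \<Longrightarrow> h (aadd gr f g) = aadd alg (h f) (h g)"
    and h_scale: "f \<in> acarrier gr \<Longrightarrow> h (ascale gr c f) = ascale alg c (h f)"
    and h_br: "\<lbrakk>f \<in> acarrier gr; g \<in> acarrier gr\<rbrakk> \<Longrightarrow> h (abr gr f g) = abr alg (h f) (h g)"
begin

text \<open>
  The isomorphism \<open>h\<close> need not respect degrees, but it maps the class of \<open>x \<in> lcs k\<close> into the part of
  degree at least \<open>k\<close>. So the coordinates of degree \<open>k\<close> of \<open>symbol k x\<close> play the role of the
  leading term of \<open>x\<close>, and they are multiplicative.
\<close>

definition symbol :: "nat \<Rightarrow> 'a \<Rightarrow> tau_idx \<Rightarrow> complex" where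
  "symbol k x = h (gr_elem k x)"

lemma symbol_add:
  assumes "x \<in> lcs k" "y \<in> lcs k"
  shows "symbol k (x + y) l = symbol k x l + symbol k y l"
  unfolding symbol_def gr_elem_add[symmetric]
  using h_add[OF assms[THEN gr_elem_in_carrier]] by (simp add: antisym_alg_def)

lemma symbol_scale:
  assumes "x \<in> lcs k"
  shows "symbol k (c *s x) l = c * symbol k x l"
  unfolding symbol_def gr_elem_scale[symmetric]
  using h_scale[OF assms[THEN gr_elem_in_carrier]] by (simp add: antisym_alg_def)

lemma symbol_0: "symbol k 0 l = 0"
  using symbol_scale[of 0 k 0 l] by simp

lemma symbol_eq_0: "x \<in> lcs (Suc k) \<Longrightarrow> symbol k x l = 0"
  using gr_elem_eq_zero[of x k k] symbol_0[of k l] by (simp add: symbol_def)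

lemma symbol_br:
  assumes "x \<in> lcs k" "1 \<le> k"
  shows "symbol (Suc k) (br x y) = abr alg (symbol k x) (symbol 1 y)"
  unfolding symbol_def gr_elem_br[OF assms, symmetric]
  by (rule h_br) (use assms in \<open>auto intro!: gr_elem_in_carrier\<close>)

text \<open>\<open>lcs (Suc k)\<close> is spanned by brackets with left factor in
  \<open>lcs k\<close>, and each bracket raises the filtration by \<open>br_filt\<close>.\<close>

lemma symbol_filt:
  assumes "1 \<le> k" "x \<in> lcs k"
  shows "symbol k x \<in> filt k"
  using assms
proof (induction k arbitrary: x rule: dec_induct)
  case base
  then show ?case using deg_pos by (fastforce simp: filt_def)
next
  case (step k)
  note IH = step.IH
  from step have "x \<in> span {br x y |x y. x \<in> lcs k}" by (simp add: lcs_Suc)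
  then have "x \<in> lcs (Suc k) \<and> symbol (Suc k) x \<in> filt (Suc k)"
  proof (induction rule: span_induct_alt)
    case base
    then show ?case by (simp add: symbol_0 filt_def)
  next
    case (step c w z)
    then obtain x y where w: "w = br x y" "x \<in> lcs k" by blast
    have wl: "w \<in> lcs (Suc k)" using w \<open>1 \<le> k\<close> br_in_lcs_Suc by blast
    have "symbol (Suc k) w \<in> filt (Suc k)"
      unfolding w(1) symbol_br[OF w(2) \<open>1 \<le> k\<close>]
      by (rule br_filt) (rule IH[OF w(2)])
    with step.IH wl show ?case
      by (auto simp: filt_def symbol_add symbol_scale lcs_scale intro!: lcs_add)
  qed
  then show ?case by blast
qed

lemma symbol_outside: "x \<in> lcs k \<Longrightarrow> l \<notin> bas \<Longrightarrow> symbol k x l = 0"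
  using h_bij gr_elem_in_carrier[of x k]
  by (auto simp: symbol_def antisym_alg_def bij_betw_def)

lemma symbol_inj:
  assumes "x \<in> lcs k" "1 \<le> k" "\<And>l. l \<in> bas \<Longrightarrow> k \<le> deg l \<Longrightarrow> symbol k x l = 0"
  shows "x \<in> lcs (Suc k)"
proof -
  have "symbol k x l = 0" for l
    using symbol_outside[OF assms(1), of l] symbol_filt[OF assms(2,1)] assms(3)[of l]
    by (cases "l \<in> bas") (auto simp: filt_def not_le[symmetric])
  then have "h (gr_elem k x) = h (gr_elem k 0)"
    using symbol_0[of k] by (auto simp: symbol_def fun_eq_iff)
  then have "gr_elem k x = gr_elem k 0"
    using h_bij gr_elem_in_carrier[of x k] gr_elem_in_carrier[of 0 k] assms(1)
    by (auto simp: bij_betw_def dest: inj_onD)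
  then show ?thesis using gr_elem_eqD[OF nil] assms by blast
qed

text \<open>No basis element has degree above \<open>n - p\<close>, so \<open>symbol_inj\<close>
  moves such an element arbitrarily far down the sequence, where nilpotency makes it zero.\<close>

lemma lcs_top: "lcs (Suc (n - p)) = {0}"
proof -
  have "x \<in> lcs (Suc (n - p) + i)" if "x \<in> lcs (Suc (n - p))" for x i
  proof (induction i)
    case 0
    show ?case using that by simp
  next
    case (Suc i)
    have "x \<in> lcs (Suc (Suc (n - p) + i))"
    proof (rule symbol_inj[OF Suc])
      fix l assume "l \<in> bas" "Suc (n - p) + i \<le> deg l"
      then show "symbol (Suc (n - p) + i) x l = 0" using deg_le[of l] by simp
    qed simp
    then show ?case by simp
  qed
  moreover have "lcs (Suc (n - p) + nilindex) = {0}"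
    by (rule lcs_beyond_nilindex[OF nil]) simp
  ultimately show ?thesis using lcs_zero[of "Suc (n - p)"] by blast
qed

text \<open>In degree \<open>n - p\<close> the symbol has the single coordinate
  \<open>BX (n - p)\<close>, and an element is determined by it since
  \<open>lcs (Suc (n - p))\<close> is zero.\<close>

lemma top_proportional:
  assumes x: "x \<in> lcs (n - p)" and y: "y \<in> lcs (n - p)" "symbol (n - p) y (BX (n - p)) \<noteq> 0"
  shows "\<exists>c. x = c *s y"
proof -
  let ?N = "n - p"
  define c where "c = symbol ?N x (BX ?N) / symbol ?N y (BX ?N)"
  have d: "x - c *s y = x + (- c) *s y" by simp
  have xy: "x - c *s y \<in> lcs ?N" using assms by (intro lcs_diff lcs_scale)
  have "x - c *s y \<in> lcs (Suc ?N)"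
  proof (rule symbol_inj[OF xy])
    fix l assume "l \<in> bas" "?N \<le> deg l"
    then have "l = BX ?N" using deg_le[of l] deg_eq_top[of l] by simp
    then show "symbol ?N (x - c *s y) l = 0"
      unfolding d using y(2) by (simp only: symbol_add[OF x lcs_scale[OF y(1)]] symbol_scale[OF y(1)]) (simp add: c_def)
  qed (use top in auto)
  then show ?thesis using lcs_top by auto
qed

text \<open>A preimage under \<open>h\<close> of the prescribed vector may have components in all
  degrees, but those of degree at least 2 have no \<open>BX 0\<close> or \<open>BX 1\<close>
  coordinate by \<open>symbol_filt\<close>.\<close>

lemma symbol_1_surj: "\<exists>x. symbol 1 x (BX 0) = \<alpha> \<and> symbol 1 x (BX 1) = \<beta>"
proof -
  have X01: "BX 0 \<in> bas" "BX 1 \<in> bas" by (auto intro: X_mem)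
  define f where "f = (\<lambda>l. if l = BX 0 then \<alpha> else if l = BX 1 then \<beta> else (0::complex))"
  have "f \<in> acarrier alg" using X01 by (auto simp: f_def antisym_alg_def)
  then obtain g where g: "g \<in> acarrier gr" "h g = f" using h_bij unfolding bij_betw_def by (metis imageE)
  from g(1) have "\<exists>x. \<forall>l\<in>{BX 0, BX 1}. h g l = symbol 1 x l"
  proof (induction rule: gr_induct)
    case zero
    show ?case by (auto simp: symbol_def)
  next
    case (step f k x)
    then obtain y where y: "\<forall>l\<in>{BX 0, BX 1}. h f l = symbol 1 y l" by blast
    have *: "h (aadd gr f (gr_elem k x)) l = h f l + symbol k x l" for l
      using h_add[OF \<open>f \<in> acarrier gr\<close> gr_elem_in_carrier[OF \<open>x \<in> lcs k\<close>]] by (simp add: antisym_alg_def symbol_def)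
    show ?case
    proof (cases "k = 1")
      case True
      with y *[unfolded True] show ?thesis by (intro exI[of _ "y + x"]) (auto simp: symbol_add)
    next
      case False
      with symbol_filt[OF \<open>1 \<le> k\<close> \<open>x \<in> lcs k\<close>] X01 \<open>1 \<le> k\<close> have "\<forall>l\<in>{BX 0, BX 1}. symbol k x l = 0"
        by (auto simp: filt_def)
      with y show ?thesis by (intro exI[of _ y]) (auto simp: *)
    qed
  qed
  then show ?thesis using g(2) by (auto simp: f_def)
qed

end

section \<open>Words in two homogeneous generators\<close>

text \<open>\<open>det\<close> says that the degree one parts of \<open>u\<close> and
  \<open>v\<close> are independent; then \<open>u_X0\<close> holds for at least one of the two
  orders of the pair.\<close>

locale tau_gradation = leibniz_tau scale br n p m r t h
  for scale :: "complex \<Rightarrow> 'a::ab_group_add \<Rightarrow> 'a" (infixr "*s" 75)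
    and br n p m r t h +
  fixes V :: "int \<Rightarrow> 'a set" and a b :: int and u v :: 'a
  assumes conn: "connected_gradation V (dim UNIV)"
    and u: "u \<in> V a" and v: "v \<in> V b"
    and det: "symbol 1 u (BX 0) * symbol 1 v (BX 1) \<noteq> symbol 1 u (BX 1) * symbol 1 v (BX 0)"
    and u_X0: "symbol 1 u (BX 0) \<noteq> 0"
begin

text \<open>\<open>True\<close> stands for \<open>u\<close> and \<open>False\<close> for
  \<open>v\<close>; the leading term of \<open>letter c\<close> has coefficients \<open>al c\<close>
  at \<open>BX 0\<close> and \<open>be c\<close> at \<open>BX 1\<close>.\<close>

definition letter :: "bool \<Rightarrow> 'a" where "letter c = (if c then u else v)"
definition al :: "bool \<Rightarrow> complex" where "al c = symbol 1 (letter c) (BX 0)"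
definition be :: "bool \<Rightarrow> complex" where "be c = symbol 1 (letter c) (BX 1)"

text \<open>Left-normed products that start with \<open>br v u\<close>, so that the degree of
  \<open>word cs\<close> is \<open>length cs + 2\<close>.\<close>

definition word :: "bool list \<Rightarrow> 'a" where
  "word cs = foldl (\<lambda>x c. br x (letter c)) (br v u) cs"

definition word_wt :: "bool list \<Rightarrow> int" where
  "word_wt cs = a + b + (\<Sum>c\<leftarrow>cs. if c then a else b)"

lemma grad: "gradation V"
  using conn by (simp add: connected_gradation_def)

lemma br_hom: "x \<in> V i \<Longrightarrow> y \<in> V j \<Longrightarrow> br x y \<in> V (i + j)"
  using grad by (simp add: gradation_def)

lemma scale_hom: "x \<in> V i \<Longrightarrow> c *s x \<in> V i"
  using grad by (auto simp: gradation_def intro: subspace_scale)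

lemma word_snoc: "word (cs @ [c]) = br (word cs) (letter c)"
  by (simp add: word_def)

lemma word_hom: "word cs \<in> V (word_wt cs)"
proof (induction cs rule: rev_induct)
  case Nil
  then show ?case using br_hom[OF v u] by (simp add: word_def word_wt_def add.commute)
next
  case (snoc c cs)
  then show ?case
    using br_hom[OF snoc, of "letter c" "if c then a else b"] u v
    by (simp add: word_snoc word_wt_def letter_def add.assoc split: if_splits)
qed

lemma word_lcs: "length cs + 2 = k \<Longrightarrow> word cs \<in> lcs k"
proof (induction cs arbitrary: k rule: rev_induct)
  case Nil
  then show ?case using br_in_lcs_Suc[of 1 v u] by (auto simp: word_def numeral_2_eq_2)
next
  case (snoc c cs)
  then obtain k' where "k = Suc k'" "length cs + 2 = k'" by auto
  with br_in_lcs_Suc[OF _ snoc.IH, of k' "letter c"] show ?case by (simp add: word_snoc)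
qed

lemma word_filt: "length cs + 2 = k \<Longrightarrow> symbol k (word cs) \<in> filt k"
  using symbol_filt[OF _ word_lcs] by simp

lemma symbol_word_snoc:
  "length cs + 2 = k \<Longrightarrow>
    symbol (Suc k) (word (cs @ [c])) = abr alg (symbol k (word cs)) (symbol 1 (letter c))"
  using symbol_br[OF word_lcs, of cs k "letter c"] by (simp add: word_snoc)

lemma symbol_word_snoc_X:
  assumes "length cs + 2 = k" "k < n - p"
  shows "symbol (Suc k) (word (cs @ [c])) (BX (Suc k)) = - (al c * symbol k (word cs) (BX k)
    + (if Suc k = m then be c * symbol k (word cs) (BX k) else 0)
    + (if k = m then be c * ((of_nat m - 1) / 2) *
        (symbol k (word cs) (BX m) - symbol k (word cs) (BY (p - 1))) else 0))"
  using br_coord_X[OF word_filt[OF assms(1)]] assms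
  by (simp add: symbol_word_snoc[OF assms(1)] al_def be_def)

lemma symbol_word_snoc_Y:
  assumes "length cs + 2 = k" "1 \<le> j" "j \<le> p - 1" "deg (BY j) = Suc k"
  shows "symbol (Suc k) (word (cs @ [c])) (BY j) = - be c * symbol k (word cs) (BX k)"
  using br_coord_Y[OF word_filt[OF assms(1)] _ assms(2-4)] assms
  by (simp add: symbol_word_snoc[OF assms(1)] be_def)

text \<open>The leading coordinate of \<open>br v u\<close> is a determinant that does not vanish,
  and below degree \<open>m\<close> each further letter \<open>c\<close> multiplies the
  \<open>BX\<close> coordinate by \<open>- al c\<close>.\<close>

lemma word_X_nonzero:
  assumes "length cs + 2 = k" "k < m" "\<forall>c\<in>set cs. al c \<noteq> 0"
  shows "symbol k (word cs) (BX k) \<noteq> 0"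
  using assms
proof (induction cs arbitrary: k rule: rev_induct)
  case Nil
  have "symbol (Suc 1) (br v u) (BX 2) \<noteq> 0"
    using det by (subst symbol_br) (auto simp: br_coord_X2 mult.commute)
  then show ?case using Nil by (auto simp: word_def numeral_2_eq_2)
next
  case (snoc c cs)
  then obtain k' where k': "k = Suc k'" "length cs + 2 = k'" by auto
  have "symbol k' (word cs) (BX k') \<noteq> 0" using snoc k' by auto
  then show ?case using symbol_word_snoc_X[OF k'(2), of c] k' snoc.prems top by auto
qed

section \<open>Passing the degrees \<open>m\<close> and \<open>m + 1\<close>\<close>

context
  fixes cs :: "bool list" and \<xi> :: complex
  assumes len: "length cs = m - 3"
    and xi: "\<xi> = symbol (m - 1) (word cs) (BX (m - 1))"
begin

lemma word_m_X: "symbol m (word (cs @ [c])) (BX m) = - ((al c + be c) * \<xi>)"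
proof -
  have "length cs + 2 = m - 1" "m - 1 < n - p" "Suc (m - 1) = m" "m - 1 \<noteq> m"
    using len m_ge top by auto
  with symbol_word_snoc_X[of cs "m - 1" c] show ?thesis by (simp add: xi algebra_simps)
qed

lemma word_m_Y: "symbol m (word (cs @ [c])) (BY (p - 1)) = - be c * \<xi>"
proof -
  have "length cs + 2 = m - 1" "Suc (m - 1) = m" using len m_ge by auto
  with symbol_word_snoc_Y[of cs "m - 1" "p - 1" c] p show ?thesis by (simp add: xi)
qed

text \<open>Right multiplication by \<open>BX 1\<close> sends \<open>BX m\<close> and
  \<open>BY (p - 1)\<close> to opposite multiples of \<open>BX (m + 1)\<close>. So the coordinates
  of \<open>word_m_X\<close> and \<open>word_m_Y\<close> enter the \<open>be d\<close> term by their
  difference \<open>- al c * \<xi>\<close>.\<close>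

lemma word_Suc_m_X: "symbol (Suc m) (word (cs @ [c, d])) (BX (Suc m)) =
    (al d * (al c + be c) + be d * ((of_nat m - 1) / 2) * al c) * \<xi>"
proof -
  define q :: complex where "q = (of_nat m - 1) / 2"
  have "symbol (Suc m) (word ((cs @ [c]) @ [d])) (BX (Suc m)) =
    - (al d * - ((al c + be c) * \<xi>) + be d * q * (- ((al c + be c) * \<xi>) - - be c * \<xi>))"
    using symbol_word_snoc_X[of "cs @ [c]" m d] len m_ge top
    unfolding word_m_X word_m_Y q_def by auto
  also have "\<dots> = (al d * (al c + be c) + be d * q * al c) * \<xi>" by (simp add: algebra_simps)
  finally show ?thesis by (simp add: q_def)
qed

text \<open>The assumed factor is that of \<open>word_Suc_m_X\<close>; beyond degree
  \<open>m + 1\<close> each letter \<open>u\<close> only multiplies the coordinate by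
  \<open>- al True\<close>.\<close>

lemma word_top_nonzero:
  assumes "\<forall>c\<in>set cs. al c \<noteq> 0"
    and "al d * (al c + be c) + be d * ((of_nat m - 1) / 2) * al c \<noteq> 0"
    and "m < k" "k \<le> n - p"
  shows "symbol k (word (cs @ c # d # replicate (k - m - 1) True)) (BX k) \<noteq> 0"
  using Suc_leI[OF assms(3)] assms(4)
proof (induction k rule: dec_induct)
  case base
  have "\<xi> \<noteq> 0" unfolding xi by (rule word_X_nonzero) (use len m_ge assms in auto)
  then show ?case using assms by (simp add: word_Suc_m_X)
next
  case (step k)
  have r: "replicate (Suc k - m - 1) True = replicate (k - m - 1) True @ [True]"
    using step by (simp add: Suc_diff_Suc replicate_append_same flip: replicate_Suc)
  have "length (cs @ c # d # replicate (k - m - 1) True) + 2 = k" using step len m_ge by simp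
  from symbol_word_snoc_X[OF this, of True] step r u_X0
  show ?case by (simp add: al_def letter_def)
qed

end

text \<open>The last term of the central sequence is one-dimensional, so the two words are
  proportional; components of different weight meet only in zero.\<close>

lemma top_weights_eq:
  assumes "length cs + 2 = n - p" "length ds + 2 = n - p"
    and "symbol (n - p) (word cs) (BX (n - p)) \<noteq> 0" "symbol (n - p) (word ds) (BX (n - p)) \<noteq> 0"
  shows "word_wt cs = word_wt ds"
proof (rule ccontr)
  assume ne: "word_wt cs \<noteq> word_wt ds"
  obtain c where c: "word cs = c *s word ds"
    using top_proportional[of "word cs" "word ds"] word_lcs[OF assms(1)] word_lcs[OF assms(2)] assms(4) by blast
  then have "word cs = 0"
    using gradation_inter[OF grad ne word_hom[of cs]] scale_hom[OF word_hom[of ds], of c] by simp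
  then show False using assms(3) symbol_0 by simp
qed

section \<open>Leading terms of \<open>u\<close> and \<open>v\<close>\<close>

lemma a_neq_b: "a \<noteq> b"
proof
  assume "a = b"
  have "u \<noteq> 0" using u_X0 symbol_0 by auto
  with max_length_proportional[OF conn, of v a u] u v \<open>a = b\<close> obtain c where "v = c *s u" by auto
  then show False using det symbol_scale[of u 1 c] by simp
qed

lemma al_True: "al True \<noteq> 0"
  using u_X0 by (simp add: al_def letter_def)

text \<open>Otherwise words with a suitable letter doubled in degrees \<open>m\<close>, \<open>m + 1\<close> survive to the top degree whatever
  their inner letters are.\<close>

lemma al_False: "al False = 0"
proof (rule ccontr)
  assume F: "al False \<noteq> 0"
  then have al: "al c \<noteq> 0" for c using al_True by (cases c) auto
  define q :: complex where "q = (of_nat m - 1) / 2"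
  have "q + 1 \<noteq> 0"
    using m_ge by (simp add: q_def add_divide_distrib[symmetric] field_simps flip: of_nat_Suc)
  \<comment> \<open>If the factor vanished for both letters, both leading terms would be multiples
    of the same vector, against \<open>det\<close>.\<close>
  obtain c where c: "al c * (al c + be c) + be c * q * al c \<noteq> 0"
  proof (rule ccontr)
    assume "\<not> thesis"
    then have "al c * (al c + be c * (1 + q)) = 0" for c
      using that[of c] by (auto simp: algebra_simps)
    then have al_be: "al c = - (be c * (1 + q))" for c
      using al[of c] by (auto simp: eq_neg_iff_add_eq_0)
    have "al True * be False = be True * al False" by (simp add: al_be)
    then show False using det by (simp add: al_def be_def letter_def)
  qed
  have nz: "symbol (n - p) (word (replicate (m - 3) e @ c # c # replicate (n - p - m - 1) True))
      (BX (n - p)) \<noteq> 0" for e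
    using word_top_nonzero[of "replicate (m - 3) e" _ c c "n - p"] al c top unfolding q_def by auto
  \<comment> \<open>The two words differ only in \<open>m - 3\<close> inner letters, so equal
    weights force \<open>a = b\<close>.\<close>
  have "word_wt (replicate (m - 3) True @ c # c # replicate (n - p - m - 1) True) =
      word_wt (replicate (m - 3) False @ c # c # replicate (n - p - m - 1) True)"
    by (rule top_weights_eq[OF _ _ nz nz]) (use top m_ge in auto)
  then show False using a_neq_b m_ge by (simp add: word_wt_def sum_list_replicate)
qed

lemma be_False: "be False \<noteq> 0"
  using det al_False by (auto simp: be_def al_def letter_def)

text \<open>Otherwise the word with only \<open>u\<close> after \<open>br v u\<close> and the one
  with a single \<open>v\<close> in degree \<open>m + 1\<close> both survive to the top degree,
  which forces \<open>a = b\<close>.\<close>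

lemma al_be_True: "al True + be True * ((of_nat m + 1) / 2) = 0"
proof (rule ccontr)
  assume *: "\<not> ?thesis"
  have "al True * (al True + be True) + be True * ((of_nat m - 1) / 2) * al True =
      al True * (al True + be True * ((of_nat m + 1) / 2))" by (simp add: field_simps)
  with * al_True have 1: "al True * (al True + be True) + be True * ((of_nat m - 1) / 2) * al True \<noteq> 0"
    by simp
  have "(of_nat m :: complex) \<noteq> 1" using m_ge by simp
  then have 2: "al False * (al True + be True) + be False * ((of_nat m - 1) / 2) * al True \<noteq> 0"
    using al_False be_False al_True by simp
  have nz: "symbol (n - p) (word (replicate (m - 3) True @ True # d # replicate (n - p - m - 1) True))
      (BX (n - p)) \<noteq> 0" for d
    using word_top_nonzero[of "replicate (m - 3) True" _ d True "n - p"] al_True 1 2 top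
    by (cases d) auto
  have "word_wt (replicate (m - 3) True @ True # True # replicate (n - p - m - 1) True) =
      word_wt (replicate (m - 3) True @ True # False # replicate (n - p - m - 1) True)"
    by (rule top_weights_eq[OF _ _ nz nz]) (use top m_ge in auto)
  then show False using a_neq_b by (simp add: word_wt_def)
qed

text \<open>By \<open>al_be_True\<close> the sum is \<open>al True * (m - 1) / (m + 1)\<close>; up
  to sign it is the factor that the letter \<open>u\<close> contributes on reaching
  \<open>BX m\<close>.\<close>

lemma al_plus_be_True: "al True + be True \<noteq> 0"
proof
  assume "al True + be True = 0"
  then have be: "be True = - al True" by (simp add: eq_neg_iff_add_eq_0 add.commute)
  have "al True * (of_nat m - 1) = 0" using al_be_True unfolding be by (simp add: field_simps)
  then show False using al_True m_ge by simp
qed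

section \<open>Words and weights attached to the basis elements\<close>

text \<open>
  The words below have linearly independent leading terms. Since \<open>u\<close> satisfies \<open>al_be_True\<close>, the
  powers of its right multiplication die in degree \<open>m + 1\<close>, and degrees \<open>m + 1\<close> and \<open>m + 2\<close> are
  reached from \<open>[\<dots>[[v, u], u], \<dots>, v]\<close> of degree \<open>m\<close> instead.
\<close>

fun idx_word :: "tau_idx \<Rightarrow> bool list" where
  "idx_word (BX k) = (if k \<le> m then replicate (k - 2) True
     else replicate (m - 3) True @ False # True # replicate (k - m - 1) True)"
| "idx_word (BY j) = replicate (deg (BY j) - 3) True @ [False]"

text \<open>The generators are assigned directly, as the shortest word is already
  \<open>br v u\<close>.\<close>

definition elt :: "tau_idx \<Rightarrow> 'a" where
  "elt l = (if l = BX 0 then u else if l = BX 1 then v else word (idx_word l))"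

definition wt :: "tau_idx \<Rightarrow> int" where
  "wt l = (if l = BX 0 then a else if l = BX 1 then b else word_wt (idx_word l))"

lemma elt_hom: "elt l \<in> V (wt l)"
  using u v word_hom by (auto simp: elt_def wt_def)

lemma length_idx_word:
  "l \<in> bas \<Longrightarrow> l \<noteq> BX 0 \<Longrightarrow> l \<noteq> BX 1 \<Longrightarrow> length (idx_word l) + 2 = deg l"
  using m_ge by (elim bas_cases) auto

lemma elt_lcs: "l \<in> bas \<Longrightarrow> elt l \<in> lcs (deg l)"
  using word_lcs[OF length_idx_word, of l] by (auto simp: elt_def)

lemma word_power_nonzero: "2 \<le> k \<Longrightarrow> k < m \<Longrightarrow> symbol k (word (replicate (k - 2) True)) (BX k) \<noteq> 0"
  by (rule word_X_nonzero) (auto simp: al_True)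

text \<open>The last letter \<open>v\<close> carries the nonzero coordinate of a power word to
  \<open>BY j\<close>, with factor \<open>- be False\<close>.\<close>

lemma word_idx_Y:
  assumes "1 \<le> j" "j \<le> p - 1"
  shows "symbol (deg (BY j)) (word (idx_word (BY j))) (BY j) \<noteq> 0"
proof -
  define k where "k = deg (BY j) - 1"
  from Y_mem[OF assms] have k: "deg (BY j) = Suc k" "2 \<le> k" "k < m"
    using m_ge by (cases rule: bas_cases; force simp: k_def)+
  have "symbol (Suc k) (word (replicate (k - 2) True @ [False])) (BY j) \<noteq> 0"
    using symbol_word_snoc_Y[OF _ assms k(1), of "replicate (k - 2) True" False] word_power_nonzero[OF k(2,3)]
      be_False k by simp
  then show ?thesis using k by (simp del: tau_deg.simps add: numeral_3_eq_3 numeral_2_eq_2)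
qed

text \<open>Degree \<open>m\<close> contains \<open>BX m\<close> and \<open>BY (p - 1)\<close> at
  once; their words extend one word of degree \<open>m - 1\<close>, with coordinate
  \<open>\<xi>\<close>, by \<open>u\<close> and by \<open>v\<close>.\<close>

lemma word_idx_m:
  obtains \<xi> where "\<xi> \<noteq> 0"
    "symbol m (elt (BX m)) (BX m) = - ((al True + be True) * \<xi>)"
    "symbol m (elt (BX m)) (BY (p - 1)) = - be True * \<xi>"
    "symbol m (elt (BY (p - 1))) (BX m) = - be False * \<xi>"
    "symbol m (elt (BY (p - 1))) (BY (p - 1)) = - be False * \<xi>"
proof -
  let ?cs = "replicate (m - 3) True"
  define \<xi> where "\<xi> = symbol (m - 1) (word ?cs) (BX (m - 1))"
  have len: "length ?cs = m - 3" by simp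
  have "replicate (m - 2) True = ?cs @ [True]"
    using m_ge by (simp add: replicate_append_same flip: replicate_Suc)
  then have "elt (BX m) = word (?cs @ [True])" "elt (BY (p - 1)) = word (?cs @ [False])"
    using m_ge by (auto simp: elt_def)
  moreover have "\<xi> \<noteq> 0" using word_power_nonzero[of "m - 1"] m_ge by (simp add: \<xi>_def numeral_3_eq_3 numeral_2_eq_2)
  ultimately show thesis
    using that[of \<xi>] word_m_X[OF len \<xi>_def] word_m_Y[OF len \<xi>_def] al_False by simp
qed

lemma symbol_elt: "l \<in> bas \<Longrightarrow> symbol (deg l) (elt l) l \<noteq> 0"
proof (cases l)
  case (BX k)
  assume l: "l \<in> bas"
  consider "k = 0" | "k = 1" | "2 \<le> k" "k < m" | "k = m" | "m < k" by linarith
  then show ?thesis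
  proof cases
    case 1
    then show ?thesis using BX u_X0 by (simp add: elt_def)
  next
    case 2
    then show ?thesis using BX be_False by (simp add: elt_def be_def letter_def)
  next
    case 3
    then show ?thesis using BX word_power_nonzero by (simp add: elt_def)
  next
    case 4
    obtain \<xi> where "\<xi> \<noteq> 0" "symbol m (elt (BX m)) (BX m) = - ((al True + be True) * \<xi>)"
      by (rule word_idx_m)
    then show ?thesis using 4 BX al_plus_be_True m_ge by simp
  next
    case 5
    have "k \<le> n - p" using l BX by (auto simp: tau_basis_def)
    \<comment> \<open>The factor required by \<open>word_top_nonzero\<close> for the letters
      \<open>v\<close>, \<open>u\<close> is \<open>al True * be False\<close>.\<close>
    then have "symbol k (word (replicate (m - 3) True @ False # True # replicate (k - m - 1) True)) (BX k) \<noteq> 0"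
      using word_top_nonzero[of "replicate (m - 3) True" _ True False k] 5 al_True al_False be_False
      by simp
    then show ?thesis using 5 BX m_ge by (simp add: elt_def)
  qed
next
  case (BY j)
  assume "l \<in> bas"
  then show ?thesis using word_idx_Y[of j] BY by (auto simp: tau_basis_def elt_def)
qed

lemma elt_nonzero: "l \<in> bas \<Longrightarrow> elt l \<noteq> 0"
  using symbol_elt[of l] symbol_0 by auto

lemma wt_eq_proportional:
  assumes "l \<in> bas" "l' \<in> bas" "wt l = wt l'"
  shows "\<exists>c. elt l = c *s elt l'"
  using max_length_proportional[OF conn elt_hom[of l], of "elt l'"] elt_hom[of l'] elt_nonzero assms
  by simp

text \<open>Equal weights make the two elements proportional, so a larger \<open>deg l'\<close>
  would push \<open>elt l\<close> into \<open>lcs (Suc (deg l))\<close>, against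
  \<open>symbol_elt\<close>.\<close>

lemma wt_eq_deg_le:
  assumes l: "l \<in> bas" "l' \<in> bas" and "wt l = wt l'"
  shows "deg l' \<le> deg l"
proof (rule ccontr)
  assume "\<not> ?thesis"
  then have "lcs (deg l') \<subseteq> lcs (Suc (deg l))" by (intro lcs_antimono) simp
  moreover obtain c where "elt l = c *s elt l'" using wt_eq_proportional[OF assms] by blast
  ultimately have "elt l \<in> lcs (Suc (deg l))" using elt_lcs[OF l(2)] lcs_scale by auto
  then show False using symbol_eq_0 symbol_elt[OF l(1)] by blast
qed

text \<open>Proportional elements of equal degree have proportional symbols. This fails in degree 1
  since \<open>v\<close> has no \<open>BX 0\<close> coordinate, in degree \<open>r j\<close> since a
  word ending in \<open>v\<close> has no \<open>BX\<close> coordinate there, and in degree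
  \<open>m\<close> since the coordinates at \<open>BX m\<close> and \<open>BY (p - 1)\<close> agree
  for only one of the two words.\<close>

lemma wt_X_neq:
  assumes l: "BX k \<in> bas" "l \<in> bas" "l \<noteq> BX k" and d: "deg (BX k) = deg l"
  shows "wt (BX k) \<noteq> wt l"
proof
  assume "wt (BX k) = wt l"
  then obtain c where c: "elt (BX k) = c *s elt l" "c \<noteq> 0"
    using wt_eq_proportional[OF l(1,2)] elt_nonzero[OF l(1)] by force
  have s: "symbol (deg l) (elt (BX k)) i = c * symbol (deg l) (elt l) i" for i
    unfolding c(1) by (rule symbol_scale) (rule elt_lcs[OF l(2)])
  have nz: "symbol (deg l) (elt (BX k)) (BX k) \<noteq> 0" using symbol_elt[OF l(1)] d by simp
  from l(2) show False
  proof (cases rule: bas_cases)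
    case (1 i)
    then have "i = 0 \<and> k = 1 \<or> i = 1 \<and> k = 0" using d l(3) by (auto split: if_splits)
    then show False
      using s[of "BX 0"] al_False al_True c(2) 1 by (auto simp: elt_def al_def letter_def)
  next
    case (2 j)
    have "k = r j" using d 2 by (auto split: if_splits)
    have "replicate (r j - 3) True @ [False] = idx_word (BY j)" using 2 by simp
    then have "symbol (Suc (r j - 1)) (word (idx_word (BY j))) (BX (Suc (r j - 1))) = 0"
      using symbol_word_snoc_X[of "replicate (r j - 3) True" "r j - 1" False] 2 top al_False by auto
    then show False using nz s[of "BX k"] 2 \<open>k = r j\<close> by (simp add: elt_def)
  next
    case 3
    have "k = m" using d 3 m_ge by (auto split: if_splits)
    obtain \<xi> where \<xi>: "\<xi> \<noteq> 0"
      "symbol m (elt (BX m)) (BX m) = - ((al True + be True) * \<xi>)"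
      "symbol m (elt (BX m)) (BY (p - 1)) = - be True * \<xi>"
      "symbol m (elt (BY (p - 1))) (BX m) = - be False * \<xi>"
      "symbol m (elt (BY (p - 1))) (BY (p - 1)) = - be False * \<xi>"
      by (rule word_idx_m)
    have "symbol m (elt (BX m)) (BX m) = symbol m (elt (BX m)) (BY (p - 1))"
      using s \<xi>(4,5) 3 \<open>k = m\<close> by simp
    then have "al True * \<xi> = 0" unfolding \<xi>(2,3) by (simp add: algebra_simps)
    then show False using al_True \<xi>(1) by simp
  qed
qed

text \<open>Equal weights force equal degrees, and two distinct \<open>BY\<close> never share a
  degree, so one of the two is a \<open>BX\<close> and \<open>wt_X_neq\<close> applies.\<close>

lemma inj_wt: "inj_on wt bas"
proof (rule inj_onI, rule ccontr)
  fix l l' assume l: "l \<in> bas" "l' \<in> bas" "wt l = wt l'" "l \<noteq> l'"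
  have d: "deg l = deg l'" using wt_eq_deg_le[of l l'] wt_eq_deg_le[of l' l] l by simp
  show False
  proof (cases l)
    case (BX k)
    then show False using wt_X_neq[of k l'] l d by simp
  next
    case l': (BY j)
    show False
    proof (cases l')
      case (BX k)
      then show False using wt_X_neq[of k l] l d by simp
    next
      case (BY j')
      have "r i < m" if "i \<in> {1..p - 2}" for i
        using admissible_upper[OF adm, of i] that by simp
      moreover have "r i < r i'" if "1 \<le> i" "i < i'" "i' \<le> p - 2" for i i'
        using admissible_less[OF adm that] .
      ultimately show False using l d l' BY
        by (cases j j' rule: linorder_cases) (fastforce simp: tau_basis_def split: if_splits)+
    qed
  qed
qed

text \<open>The support of the gradation is an interval of \<open>n\<close> integers and contains
  the \<open>n\<close> distinct weights, which therefore fill it.\<close>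

lemma inconsistent: False
proof -
  obtain c t where ct: "{i. V i \<noteq> {0}} = {c..c + int t}" "n = t + 1"
    using conn dim_n by (auto simp: connected_gradation_def)
  have "wt ` bas \<subseteq> {c..c + int n - 1}"
  proof
    fix i assume "i \<in> wt ` bas"
    then obtain l where "l \<in> bas" "i = wt l" by auto
    then have "i \<in> {i. V i \<noteq> {0}}" using elt_hom[of l] elt_nonzero[of l] by auto
    then show "i \<in> {c..c + int n - 1}" using ct by simp
  qed
  moreover have "card (wt ` bas) = card {c..c + int n - 1}"
  proof -
    have "p \<le> n" using top by arith
    then show ?thesis using card_image[OF inj_wt] card_tau_basis[of p n] p by simp
  qed
  ultimately have img: "wt ` bas = {c..c + int n - 1}"
    by (intro card_subset_eq) auto
  show False
  proof (rule weights_not_interval[OF p adm top inj_wt img, of a b])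
    show "wt (BX 0) = a" by (simp add: wt_def)
  next
    fix k assume "1 \<le> k" "k \<le> m"
    then show "wt (BX k) = b + (int k - 1) * a"
      by (cases "k = 1") (auto simp: wt_def word_wt_def sum_list_replicate of_nat_diff algebra_simps)
  next
    fix k assume "m < k"
    then show "wt (BX k) = 2 * b + (int k - 2) * a"
      using m_ge by (simp add: wt_def word_wt_def sum_list_replicate of_nat_diff algebra_simps)
  next
    fix j assume "1 \<le> j" "j \<le> p - 2"
    then show "wt (BY j) = 2 * b + (int (r j) - 2) * a"
      using admissible_lower[OF adm, of j]
      by (auto simp: wt_def word_wt_def sum_list_replicate of_nat_diff algebra_simps)
  next
    show "wt (BY (p - 1)) = 2 * b + (int m - 2) * a"
      using m_ge by (simp add: wt_def word_wt_def sum_list_replicate of_nat_diff algebra_simps)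
  qed
qed

end

section \<open>Existence of homogeneous generators\<close>

context leibniz_tau
begin

text \<open>The determinant of the degree one parts is bilinear, so if it vanished on homogeneous
  pairs it would vanish everywhere, contrary to \<open>symbol_1_surj\<close>.\<close>

lemma homogeneous_generators:
  assumes V: "gradation V"
  shows "\<exists>i j u v. u \<in> V i \<and> v \<in> V j \<and>
    symbol 1 u (BX 0) * symbol 1 v (BX 1) \<noteq> symbol 1 u (BX 1) * symbol 1 v (BX 0)"
proof (rule ccontr)
  assume *: "\<not> ?thesis"
  have sum0: "symbol 1 (\<Sum>i\<in>I. f i) l = (\<Sum>i\<in>I. symbol 1 (f i) l)" for f :: "int \<Rightarrow> 'a" and I l
    by (induction I rule: infinite_finite_induct) (auto simp: symbol_0 symbol_add)
  have "symbol 1 x (BX 0) * symbol 1 y (BX 1) = symbol 1 x (BX 1) * symbol 1 y (BX 0)" for x y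
  proof -
    obtain f where f: "\<And>i. f i \<in> V i" "x = (\<Sum>i | V i \<noteq> {0}. f i)"
      using V unfolding gradation_def by metis
    obtain g where g: "\<And>i. g i \<in> V i" "y = (\<Sum>i | V i \<noteq> {0}. g i)"
      using V unfolding gradation_def by metis
    show ?thesis
      unfolding f(2) g(2) sum0 sum_product using * f(1) g(1) by (intro sum.cong refl) blast
  qed
  moreover obtain x y where "symbol 1 x (BX 0) = 1" "symbol 1 x (BX 1) = 0"
    "symbol 1 y (BX 0) = 0" "symbol 1 y (BX 1) = 1"
    using symbol_1_surj[of 1 0] symbol_1_surj[of 0 1] by blast
  ultimately show False by (metis mult_1 mult_zero_left zero_neq_one)
qed

lemma not_admits_max_length_gradation: "\<not> admits_max_length_gradation"
proof
  assume "admits_max_length_gradation"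
  then obtain V where V: "connected_gradation V (dim UNIV)"
    by (auto simp: admits_max_length_gradation_def)
  then obtain i j u v where uv: "u \<in> V i" "v \<in> V j"
    and det: "symbol 1 u (BX 0) * symbol 1 v (BX 1) \<noteq> symbol 1 u (BX 1) * symbol 1 v (BX 0)"
    using homogeneous_generators[of V] by (auto simp: connected_gradation_def)
  show False
  proof (cases "symbol 1 u (BX 0) = 0")
    case False
    then interpret tau_gradation scale br n p m r t h V i j u v
      using V uv det by unfold_locales auto
    show ?thesis by (rule inconsistent)
  next
    case True
    \<comment> \<open>Here \<open>det\<close> gives \<open>symbol 1 v (BX 0) \<noteq> 0\<close>, so
      \<open>u\<close> and \<open>v\<close> exchange roles.\<close>
    then interpret tau_gradation scale br n p m r t h V j i v u
      using V uv det by unfold_locales (auto simp: mult.commute)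
    show ?thesis by (rule inconsistent)
  qed
qed

end

lemma leibniz_tau_exists:
  fixes scale :: "complex \<Rightarrow> 'a::ab_group_add \<Rightarrow> 'a" and br :: "'a \<Rightarrow> 'a \<Rightarrow> 'a"
  assumes "leibniz_algebra scale br" "vector_space.dim scale (UNIV :: 'a set) = n"
    and "leibniz_algebra.p_filiform scale br p"
    and "tau_structure n p m r t"
    and "calg_iso (leibniz_algebra.gr scale br) (antisym_alg (tau_basis n p) t)"
  shows "\<exists>h. leibniz_tau scale br n p m r t h"
proof -
  interpret leibniz_algebra scale br by fact
  interpret tau_structure n p m r t by fact
  from assms(5) obtain h where h: "bij_betw h (acarrier gr) (acarrier alg)"
    "\<forall>x\<in>acarrier gr. \<forall>y\<in>acarrier gr. h (aadd gr x y) = aadd alg (h x) (h y)"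
    "\<forall>c. \<forall>x\<in>acarrier gr. h (ascale gr c x) = ascale alg c (h x)"
    "\<forall>x\<in>acarrier gr. \<forall>y\<in>acarrier gr. h (abr gr x y) = abr alg (h x) (h y)"
    unfolding calg_iso_def by blast
  have "leibniz_tau scale br n p m r t h"
    by unfold_locales (use assms(2,3) h in \<open>auto simp: p_filiform_def\<close>)
  then show ?thesis by blast
qed

theorem theorem3p2:
  fixes n p :: nat
    and scale :: "complex \<Rightarrow> 'a::ab_group_add \<Rightarrow> 'a"
    and br :: "'a \<Rightarrow> 'a \<Rightarrow> 'a"
  assumes "p \<ge> 4" and "n \<ge> max (3 * p - 1) (p + 8)"
    and "leibniz_algebra scale br"
    and "vector_space.dim scale (UNIV :: 'a set) = n"
    and "\<not> leibniz_algebra.split scale br"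
    and "leibniz_algebra.p_filiform scale br p"
    and "(\<exists>r. admissible p r (n - p - 1) \<and>
            calg_iso (leibniz_algebra.gr scale br) (tau1 n p r)) \<or>
         (\<exists>r. admissible p r (n - p - 2) \<and>
            calg_iso (leibniz_algebra.gr scale br) (tau2 n p r))"
  shows "\<not> leibniz_algebra.admits_max_length_gradation scale br"
proof -
  obtain m r t where "tau_structure n p m r t"
    "calg_iso (leibniz_algebra.gr scale br) (antisym_alg (tau_basis n p) t)"
    using assms(7) tau_structure_tau1[OF assms(1)] tau_structure_tau2[OF assms(1)]
    unfolding tau1_def tau2_def by blast
  then obtain h where "leibniz_tau scale br n p m r t h"
    using leibniz_tau_exists[OF assms(3,4,6)] by blast
  then show ?thesis by (rule leibniz_tau.not_admits_max_length_gradation)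
qed

end
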